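(* Let $\boldsymbol X\sim P$ be a random vector in $\mathbb{R}^m$ such that $P(L)=0$ for all hyperplanes $L\subset\mathbb{R}^m$ and $\mathbb{E}[\|\boldsymbol X\|^{\alpha}]<\infty$ for some $\alpha>1$. Then $\sigma_H(\hat P_n)\to\sigma_H(P)$ and $\sigma_\Delta(\hat P_n)\to\sigma_\Delta(P)$ almost surely as $n\to\infty$.
   Context: $\hat P_n$ is the empirical measure of $\boldsymbol X_1,\dots,\boldsymbol X_n$, where $(\boldsymbol X_i)_{i\ge1}$ are i.i.d. with distribution $P$. For a distribution $Q$ on $\mathbb{R}^m$: the halfspace depth is $d_H(\boldsymbol x,Q)=\inf_{\boldsymbol u\in S^{m-1}}Q(\{\boldsymbol y:\langle\boldsymbol u,\boldsymbol y\rangle\le\langle\boldsymbol u,\boldsymbol x\rangle\})$, with $S^{m-1}$ the unit sphere; the simplicial depth is $d_\Delta(\boldsymbol x,Q)=\mathbb{P}(\boldsymbol x\in\Delta[\boldsymbol Y_1,\dots,\boldsymbol Y_{m+1}])$, with $\boldsymbol Y_i$ i.i.d. with distribution $Q$ and $\Delta[\cdot]$ the closed simplex (convex hull) with the given vertices. $\sigma_H(Q)=\int_{\mathbb{R}^m}d_H(\boldsymbol x,Q)\,d\boldsymbol x$ and $\sigma_\Delta(Q)=\int_{\mathbb{R}^m}d_\Delta(\boldsymbol x,Q)\,d\boldsymbol x$. Hyperplanes are affine hyperplanes. *)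

theory Defs
  imports "HOL-Probability.Probability"
begin

text \<open>
  The distribution placing mass \<open>1 / n\<close> on each of \<open>x 0, \<dots>, x (n - 1)\<close> (with multiplicity), as the
  push-forward of the uniform distribution on the indices. For \<open>n = 0\<close> it is the null measure.
\<close>
definition empirical_measure :: "(nat \<Rightarrow> 'a::topological_space) \<Rightarrow> nat \<Rightarrow> 'a measure" where
  "empirical_measure x n = distr (uniform_count_measure {..<n}) borel x"

lemma measure_empirical_measure:
  assumes "A \<in> sets borel"
  shows "measure (empirical_measure x n) A = card {i \<in> {..<n}. x i \<in> A} / n"
proof -
  have "measure (empirical_measure x n) A =
      measure (uniform_count_measure {..<n}) {i \<in> {..<n}. x i \<in> A}"
    unfolding empirical_measure_def using assms
    by (subst measure_distr)
      (auto simp: space_uniform_count_measure intro!: arg_cong2[where f = measure])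
  also have "\<dots> = card {i \<in> {..<n}. x i \<in> A} / n"
    by (subst measure_uniform_count_measure) auto
  finally show ?thesis .
qed

definition halfspace_depth :: "'a::euclidean_space \<Rightarrow> 'a measure \<Rightarrow> real" where
  "halfspace_depth x Q = (INF u\<in>sphere 0 1. measure Q {y. u \<bullet> y \<le> u \<bullet> x})"

definition simplicial_depth :: "'a::euclidean_space \<Rightarrow> 'a measure \<Rightarrow> real" where
  "simplicial_depth x Q =
    measure (\<Pi>\<^sub>M i\<in>{1..DIM('a) + 1}. Q)
      {Y \<in> space (\<Pi>\<^sub>M i\<in>{1..DIM('a) + 1}. Q). x \<in> convex hull (Y ` {1..DIM('a) + 1})}"

text \<open>
  The integrals over the whole space take values in \<open>[0, \<infinity>]\<close>: a distribution with a finite moment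
  of some order \<open>\<alpha> > 1\<close> may have an infinite integrated halfspace depth in dimension at least 2.
\<close>
definition sigma_halfspace :: "'a::euclidean_space measure \<Rightarrow> ennreal" where
  "sigma_halfspace Q = (\<integral>\<^sup>+x. ennreal (halfspace_depth x Q) \<partial>lborel)"

definition sigma_simplicial :: "'a::euclidean_space measure \<Rightarrow> ennreal" where
  "sigma_simplicial Q = (\<integral>\<^sup>+x. ennreal (simplicial_depth x Q) \<partial>lborel)"

end

theory Submission
  imports Defs
begin

text \<open>
  Halfspace depth: the lower bound for \<open>sigma_halfspace\<close> of the empirical measures is Fatou's lemma, since almost surely the empirical depth is asymptotically at least the depth at every point (compactness of the sphere, and open sets do not lose mass in the limit). For the upper bound, choose measurably at each point \<open>x\<close> a halfspace \<open>H x\<close> that is nearly optimal for \<open>P\<close>. The empirical depth at \<open>x\<close> is at most the empirical mass of \<open>H x\<close>, so its integral is at most the empirical mean of \<open>g y = vol {x. y \<in> H x}\<close>, whose expectation is nearly \<open>sigma_halfspace P\<close>; the strong law for \<open>g\<close> concludes.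

  Simplicial depth: by Fubini \<open>sigma_simplicial Q\<close> is the mean volume of a simplex with independent vertices distributed as \<open>Q\<close>. The volume is bounded by a constant times the product of \<open>1 + norm\<close> over the vertices and is Lipschitz in each vertex with constant a product over the others, so a law of large numbers that is uniform over Lipschitz functions can be applied one vertex at a time.
\<close>

section \<open>The strong law of large numbers\<close>

text \<open>Depth is an infimum over directions, so \<open>sigma_halfspace\<close> is not linear in
  the measure, and it may be infinite at \<open>P\<close>. Convergence is therefore taken in
  [0, infinity] and split into one-sided bounds: the lower one alone settles an infinite limit, and
  the upper one applies the strong law only to functionals that are finite at \<open>P\<close>. The
  vanishing mass of hyperplanes enters in the lower bound, where closed halfspaces are replaced by
  open ones. For the simplicial depth, vertices under a product of empirical measures are sample
  points drawn with replacement, so the mean volume is not an average of independent terms. With the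
  other vertices frozen, the section to be averaged depends on the sample itself; hence a law that
  is uniform over a class of functions. As the vertices are independent, a product bound integrates
  to a power of one first moment. Almost sure claims about uncountably many points, open sets or
  functions must share a single null set; each is reduced to countably many instances of the strong
  law.\<close>

primrec max_partial_sum :: "('a \<Rightarrow> real) \<Rightarrow> nat \<Rightarrow> (nat \<Rightarrow> 'a) \<Rightarrow> real" where
  "max_partial_sum f 0 x = 0"
| "max_partial_sum f (Suc n) x = max 0 (f (x 0) + max_partial_sum f n (\<lambda>i. x (Suc i)))"

lemma max_partial_sum_nonneg: "max_partial_sum f n x \<ge> 0"
  by (cases n) auto

lemma max_partial_sum_mono: "max_partial_sum f n x \<le> max_partial_sum f (Suc n) x"
proof (induction n arbitrary: x)
  case (Suc n)
  then show ?case using Suc[of "\<lambda>i. x (Suc i)"] by auto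
qed auto

text \<open>\<open>max_partial_sum f n x\<close> is the running maximum of the partial sums of
  lengths 0 to \<open>n\<close>, the empty sum included. Its recursion splits off the first term,
  not the last, so that it compares a sequence with its shift.\<close>

lemma sum_le_max_partial_sum: "k \<le> n \<Longrightarrow> (\<Sum>i<k. f (x i)) \<le> max_partial_sum f n x"
proof (induction n arbitrary: x k)
  case (Suc n)
  show ?case
  proof (cases k)
    case (Suc j)
    then show ?thesis using Suc.IH[of j "\<lambda>i. x (Suc i)"] \<open>k \<le> Suc n\<close>
      by (simp add: sum.lessThan_Suc_shift del: sum.lessThan_Suc)
  qed simp
qed simp

context sequence_space
begin

lemma borel_measurable_max_partial_sum [measurable]:
  assumes [measurable]: "f \<in> borel_measurable M"
  shows "max_partial_sum f n \<in> borel_measurable S"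
proof (induction n)
  case (Suc n)
  have [measurable]: "(\<lambda>x i. x (Suc i)) \<in> S \<rightarrow>\<^sub>M S"
    by (intro measurable_PiM_single') (auto simp: space_PiM)
  have [measurable]: "(\<lambda>x. max_partial_sum f n (\<lambda>i. x (Suc i))) \<in> borel_measurable S"
    using Suc by (rule measurable_compose[rotated]) measurable
  have "(\<lambda>x. max 0 (f (x 0) + max_partial_sum f n (\<lambda>i. x (Suc i)))) \<in> borel_measurable S"
    by measurable
  then show ?case by (simp add: fun_eq_iff cong: measurable_cong)
qed (simp cong: measurable_cong)

lemma max_partial_sum_le: "max_partial_sum f n x \<le> (\<Sum>i<n. \<bar>f (x i)\<bar>)"
proof (induction n arbitrary: x)
  case (Suc n)
  show ?case using Suc[of "\<lambda>i. x (Suc i)"] sum_nonneg[of "{..<n}" "\<lambda>i. \<bar>f (x (Suc i))\<bar>"]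
    by (simp add: sum.lessThan_Suc_shift del: sum.lessThan_Suc)
qed simp

lemma integrable_coordinate:
  fixes f :: "'a \<Rightarrow> real"
  assumes f: "integrable M f"
  shows "integrable S (\<lambda>x. f (x i))"
proof -
  have "distr S M (\<lambda>x. x i) = M"
    using distr_PiM_component[of UNIV "\<lambda>_. M" i] by (simp add: prob_space_axioms M.prob_space_axioms)
  then have "integrable (distr S M (\<lambda>x. x i)) f" using f by simp
  then show ?thesis
    by (subst (asm) integrable_distr_eq) (use f in auto)
qed

lemma integrable_max_partial_sum:
  assumes f: "integrable M f"
  shows "integrable S (max_partial_sum f n)"
proof (rule Bochner_Integration.integrable_bound)
  have [measurable]: "f \<in> borel_measurable M" using f by auto
  show "integrable S (\<lambda>x. \<Sum>i<n. \<bar>f (x i)\<bar>)"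
    using f by (intro Bochner_Integration.integrable_sum integrable_abs integrable_coordinate)
  show "max_partial_sum f n \<in> borel_measurable S" by measurable
  show "AE x in S. norm (max_partial_sum f n x) \<le> norm (\<Sum>i<n. \<bar>f (x i)\<bar>)"
    using max_partial_sum_le[of f n] max_partial_sum_nonneg[of f n] by (simp add: abs_of_nonneg sum_nonneg)
qed

lemma distr_pair_snd: "distr (M \<Otimes>\<^sub>M S) S snd = S"
proof (intro measure_eqI)
  fix A assume A: "A \<in> sets (distr (M \<Otimes>\<^sub>M S) S snd)"
  then have "emeasure (distr (M \<Otimes>\<^sub>M S) S snd) A = emeasure (M \<Otimes>\<^sub>M S) (space M \<times> A)"
    by (auto simp: emeasure_distr space_pair_measure dest: sets.sets_into_space intro!: arg_cong2[where f=emeasure])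
  with A show "emeasure (distr (M \<Otimes>\<^sub>M S) S snd) A = emeasure S A"
    by (simp add: P.emeasure_pair_measure_Times M.emeasure_space_1)
qed simp

definition unbounded_max :: "('a \<Rightarrow> real) \<Rightarrow> (nat \<Rightarrow> 'a) set" where
  "unbounded_max f = {x \<in> space S. \<forall>K::nat. \<exists>n. real K < max_partial_sum f n x}"

lemma sets_unbounded_max [measurable]:
  assumes [measurable]: "f \<in> borel_measurable M"
  shows "unbounded_max f \<in> sets S"
  unfolding unbounded_max_def by measurable

text \<open>Shift invariance: prepending \<open>s\<close> moves the index by one and changes the
  running maximum by at most \<open>\<bar>f s\<bar>\<close>, which cannot affect
  unboundedness.\<close>

lemma case_nat_in_unbounded_max_iff:
  assumes "s \<in> space M" "y \<in> space S"
  shows "case_nat s y \<in> unbounded_max f \<longleftrightarrow> y \<in> unbounded_max f"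
proof
  assume *: "case_nat s y \<in> unbounded_max f"
  have "\<exists>n. real K < max_partial_sum f n y" for K
  proof -
    obtain K' :: nat where K': "real K + \<bar>f s\<bar> \<le> real K'" using real_arch_simple by blast
    obtain n where n: "real K' < max_partial_sum f n (case_nat s y)"
      using * by (auto simp: unbounded_max_def)
    also have "\<dots> \<le> max_partial_sum f (Suc n) (case_nat s y)" by (rule max_partial_sum_mono)
    finally have "real K < max_partial_sum f n y" using K' by (auto simp: max_def split: if_splits)
    then show ?thesis ..
  qed
  then show "y \<in> unbounded_max f" using assms by (auto simp: unbounded_max_def)
next
  assume *: "y \<in> unbounded_max f"
  have "\<exists>n. real K < max_partial_sum f n (case_nat s y)" for K
  proof -
    obtain K' :: nat where K': "real K + \<bar>f s\<bar> \<le> real K'" using real_arch_simple by blast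
    obtain n where n: "real K' < max_partial_sum f n y"
      using * by (auto simp: unbounded_max_def)
    then have "real K < max_partial_sum f (Suc n) (case_nat s y)" using K' by (auto simp: max_def)
    then show ?thesis ..
  qed
  then show "case_nat s y \<in> unbounded_max f"
    using assms by (auto simp: unbounded_max_def space_PiM PiE_iff split: nat.split)
qed

text \<open>
  Garsia's argument: on the shift-invariant event that the partial sums are unbounded above, the running maximum of \<open>n + 1\<close> terms exceeds that of the \<open>n\<close> terms after the first by an amount that tends to the first term; this difference has nonnegative mean, so \<open>f\<close> has nonnegative mean unless the event is null.
\<close>
lemma unbounded_max_null:
  assumes f: "integrable M f" and neg: "(\<integral>s. f s \<partial>M) < 0"
  shows "AE x in S. x \<notin> unbounded_max f"
proof -
  have fm [measurable]: "f \<in> borel_measurable M" using f by auto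
  note [measurable] = integrable_max_partial_sum[OF f]
  let ?A = "unbounded_max f" and ?N = "M \<Otimes>\<^sub>M S"
  let ?c = "\<lambda>(s, y). case_nat s y :: nat \<Rightarrow> 'a"
  have c [measurable]: "?c \<in> ?N \<rightarrow>\<^sub>M S" by measurable
  have int: "integrable S (\<lambda>x. indicator ?A x * max_partial_sum f n x)" for n
    using integrable_mult_indicator[OF sets_unbounded_max[OF fm] integrable_max_partial_sum[OF f]] by simp
  \<comment> \<open>Under \<open>?N\<close> both the extended sequence \<open>?c p\<close> and its
    tail \<open>snd p\<close> have law \<open>S\<close> (\<open>PiM_iter\<close>,
    \<open>distr_pair_snd\<close>), so running maxima of either have the same integrals.\<close>
  have int1: "integrable ?N (\<lambda>p. indicator ?A (?c p) * max_partial_sum f n (?c p))" for n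
    using int[of n] by (subst (asm) PiM_iter[symmetric], subst (asm) integrable_distr_eq) auto
  have eq1: "(\<integral>p. indicator ?A (?c p) * max_partial_sum f n (?c p) \<partial>?N) =
      (\<integral>x. indicator ?A x * max_partial_sum f n x \<partial>S)" for n
    by (subst (2) PiM_iter[symmetric], subst integral_distr) auto
  have int2: "integrable ?N (\<lambda>p. indicator ?A (snd p) * max_partial_sum f n (snd p))" for n
    using int[of n] by (subst (asm) distr_pair_snd[symmetric], subst (asm) integrable_distr_eq) auto
  have eq2: "(\<integral>p. indicator ?A (snd p) * max_partial_sum f n (snd p) \<partial>?N) =
      (\<integral>x. indicator ?A x * max_partial_sum f n x \<partial>S)" for n
    by (subst (2) distr_pair_snd[symmetric], subst integral_distr) auto
  have intf: "integrable ?N (\<lambda>p. f (fst p))"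
    using f by (subst (asm) P.distr_pair_fst[symmetric], subst (asm) integrable_distr_eq) auto
  \<comment> \<open>On the event this is the increment \<open>max 0 (f + m) - m\<close>, with
    \<open>m\<close> the running maximum of the tail. In the form \<open>max (- m) f\<close> it is
    visibly bounded by \<open>\<bar>f\<bar>\<close> and equal to \<open>f\<close> once
    \<open>m\<close> exceeds \<open>\<bar>f\<bar>\<close>.\<close>
  define F where "F = (\<lambda>n p. indicator ?A (snd p) * max (- max_partial_sum f n (snd p)) (f (fst p)))"
  have F_eq: "F n p = indicator ?A (?c p) * max_partial_sum f (Suc n) (?c p)
      - indicator ?A (snd p) * max_partial_sum f n (snd p)" if "p \<in> space ?N" for n p
    using that case_nat_in_unbounded_max_iff[of "fst p" "snd p" f]
    by (auto simp: F_def space_pair_measure indicator_def max_def split: if_splits)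
  have "0 \<le> (\<integral>p. F n p \<partial>?N)" for n
  proof -
    have "(\<integral>p. F n p \<partial>?N) = (\<integral>p. indicator ?A (?c p) * max_partial_sum f (Suc n) (?c p)
      - indicator ?A (snd p) * max_partial_sum f n (snd p) \<partial>?N)"
      by (intro Bochner_Integration.integral_cong F_eq) auto
    also have "\<dots> = (\<integral>x. indicator ?A x * max_partial_sum f (Suc n) x \<partial>S)
        - (\<integral>x. indicator ?A x * max_partial_sum f n x \<partial>S)"
      by (subst Bochner_Integration.integral_diff[OF int1 int2]) (simp only: eq1 eq2)
    also have "\<dots> \<ge> 0"
      using integral_mono[OF int int, of n "Suc n"] max_partial_sum_mono[of f n]
      by (auto intro!: mult_left_mono)
    finally show ?thesis .
  qed
  moreover have "(\<lambda>n. \<integral>p. F n p \<partial>?N) \<longlonglongrightarrow> (\<integral>p. indicator ?A (snd p) * f (fst p) \<partial>?N)"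
  proof (rule integral_dominated_convergence)
    show "integrable ?N (\<lambda>p. \<bar>f (fst p)\<bar>)" using intf by simp
    show "AE p in ?N. (\<lambda>n. F n p) \<longlonglongrightarrow> indicator ?A (snd p) * f (fst p)"
    proof (rule AE_I2)
      fix p
      show "(\<lambda>n. F n p) \<longlonglongrightarrow> indicator ?A (snd p) * f (fst p)"
      proof (cases "snd p \<in> ?A")
        case True
        obtain K :: nat where K: "\<bar>f (fst p)\<bar> \<le> real K" using real_arch_simple by blast
        obtain n0 where n0: "real K < max_partial_sum f n0 (snd p)"
          using True by (auto simp: unbounded_max_def)
        have "F n p = indicator ?A (snd p) * f (fst p)" if "n \<ge> n0" for n
          using n0 K lift_Suc_mono_le[of "\<lambda>n. max_partial_sum f n (snd p)", OF max_partial_sum_mono that]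
          by (auto simp: F_def)
        then show ?thesis
          by (intro tendsto_eventually) (auto simp: eventually_sequentially)
      qed (simp add: F_def)
    qed
    have "\<bar>max (- a) b\<bar> \<le> \<bar>b\<bar>" if "0 \<le> a" for a b :: real
      using that by (auto simp: max_def)
    then show "AE p in ?N. norm (F n p) \<le> \<bar>f (fst p)\<bar>" for n
      using max_partial_sum_nonneg[of f n] by (auto simp: F_def indicator_def)
  qed (unfold F_def, measurable)
  ultimately have "0 \<le> (\<integral>p. indicator ?A (snd p) * f (fst p) \<partial>?N)"
    by (intro LIMSEQ_le_const) auto
  also have "\<dots> = measure S ?A * (\<integral>s. f s \<partial>M)"
  proof -
    interpret MS: pair_sigma_finite M S ..
    have i: "integrable ?N (\<lambda>p. indicator ?A (snd p) * f (fst p))"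
      by (rule Bochner_Integration.integrable_bound[OF intf]) (auto simp: indicator_def)
    have "(\<integral>p. indicator ?A (snd p) * f (fst p) \<partial>?N) = (\<integral>s. \<integral>y. indicator ?A y * f s \<partial>S \<partial>M)"
      by (subst MS.integral_fst'[OF i, symmetric]) simp
    also have "\<dots> = measure S ?A * (\<integral>s. f s \<partial>M)" by simp
    finally show ?thesis .
  qed
  finally have "measure S ?A = 0" using neg measure_nonneg[of S ?A]
    by (auto simp: zero_le_mult_iff)
  then show ?thesis
    by (intro AE_not_in) (simp add: emeasure_eq_measure null_sets_def)
qed

text \<open>The function \<open>f - c\<close> has strictly negative mean, so almost surely its
  partial sums stay below some \<open>K\<close>, and \<open>K / n\<close> drops below every
  \<open>e\<close>. Letting \<open>c\<close> descend to the mean is left to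
  \<open>strong_law\<close>.\<close>

lemma AE_eventually_average_le:
  assumes f: "integrable M f" and "(\<integral>s. f s \<partial>M) < c"
  shows "AE x in S. \<forall>e>0. \<forall>\<^sub>F n in sequentially. (\<Sum>i<n. f (x i)) / n \<le> c + e"
proof -
  let ?g = "\<lambda>s. f s - c"
  have g: "integrable M ?g" using f by simp
  have "AE x in S. x \<notin> unbounded_max ?g"
    using assms by (intro unbounded_max_null g) (simp add: M.prob_space)
  then show ?thesis
  proof (rule AE_mp, intro AE_I2 impI allI)
    fix x e assume x: "x \<in> space S" "x \<notin> unbounded_max ?g" and e: "(0::real) < e"
    obtain K :: nat where K: "\<And>n. max_partial_sum ?g n x \<le> real K"
      using x by (auto simp: unbounded_max_def not_less)
    obtain n0 :: nat where n0: "K / e < n0" using reals_Archimedean2 by blast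
    have "(\<Sum>i<n. f (x i)) / n \<le> c + e" if "n > n0" for n
    proof -
      have "(\<Sum>i<n. f (x i)) - n * c = (\<Sum>i<n. ?g (x i))" by (simp add: sum_subtractf)
      also have "\<dots> \<le> K" using sum_le_max_partial_sum[of n n ?g x] K[of n] by linarith
      also have "real K \<le> n * e" using n0 that e by (simp add: field_simps) 
         (meson less_eq_real_def mult_left_mono of_nat_less_iff order_less_le_trans order_trans)
      finally show ?thesis using that by (simp add: field_simps)
    qed
    then show "\<forall>\<^sub>F n in sequentially. (\<Sum>i<n. f (x i)) / n \<le> c + e"
      unfolding eventually_at_top_dense by blast
  qed
qed

text \<open>The one-sided bound is applied to \<open>f\<close> and to \<open>- f\<close>, with
  \<open>c\<close> above the mean by \<open>1 / Suc k\<close> for countably many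
  \<open>k\<close>.\<close>

lemma strong_law:
  assumes f: "integrable M f"
  shows "AE x in S. (\<lambda>n. (\<Sum>i<n. f (x i)) / n) \<longlonglongrightarrow> (\<integral>s. f s \<partial>M)"
proof -
  let ?c = "\<integral>s. f s \<partial>M"
  let ?e = "\<lambda>k. 1 / real (Suc k)"
  have "AE x in S. \<forall>k. \<forall>e>0. \<forall>\<^sub>F n in sequentially. (\<Sum>i<n. f (x i)) / n \<le> ?c + ?e k + e"
    unfolding AE_all_countable by (intro allI AE_eventually_average_le f) simp
  moreover have "AE x in S. \<forall>k. \<forall>e>0. \<forall>\<^sub>F n in sequentially. (\<Sum>i<n. - f (x i)) / n \<le> - ?c + ?e k + e"
    unfolding AE_all_countable
    by (intro allI AE_eventually_average_le integrable_minus f) simp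
  ultimately show ?thesis
  proof eventually_elim
    case (elim x)
    show ?case
    proof (rule LIMSEQ_I)
      fix r :: real assume r: "0 < r"
      obtain k where k: "?e k < r / 2" using r nat_approx_posE[of "r/2"] by (metis half_gt_zero)
      have "\<forall>\<^sub>F n in sequentially. (\<Sum>i<n. f (x i)) / n \<le> ?c + ?e k + r / 4"
        "\<forall>\<^sub>F n in sequentially. (\<Sum>i<n. - f (x i)) / n \<le> - ?c + ?e k + r / 4"
        using elim r by auto
      then have "\<forall>\<^sub>F n in sequentially. norm ((\<Sum>i<n. f (x i)) / n - ?c) < r"
      proof eventually_elim
        case (elim n)
        then show ?case using k r unfolding sum_negf minus_divide_left[symmetric] real_norm_def by linarith
      qed
      then show "\<exists>n0. \<forall>n\<ge>n0. norm ((\<Sum>i<n. f (x i)) / n - ?c) < r"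
        by (simp add: eventually_sequentially)
    qed
  qed
qed

end

text \<open>The joint law of the whole sequence is the product measure, so the almost sure statement
  on the sequence space pulls back to \<open>M\<close>.\<close>

lemma (in prob_space) strong_law_iid:
  fixes X :: "nat \<Rightarrow> 'a \<Rightarrow> 'b::topological_space" and f :: "'b \<Rightarrow> real"
  assumes indep: "indep_vars (\<lambda>_. borel) X UNIV" and distr: "\<And>i. distr M borel (X i) = P"
    and f: "integrable P f"
  shows "AE \<omega> in M. (\<lambda>n. (\<Sum>i<n. f (X i \<omega>)) / n) \<longlonglongrightarrow> (\<integral>y. f y \<partial>P)"
proof -
  have X [measurable]: "X i \<in> M \<rightarrow>\<^sub>M borel" for i
    using indep by (auto simp: indep_vars_def2)
  have P: "prob_space P" using prob_space_distr[OF X[of 0]] distr by simp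
  have [measurable_cong]: "sets P = sets borel" using distr[of 0] by auto
  have [measurable]: "f \<in> borel_measurable P" using f by auto
  have *: "distr M (\<Pi>\<^sub>M i\<in>UNIV. borel) (\<lambda>\<omega>. \<lambda>i\<in>UNIV. X i \<omega>) = (\<Pi>\<^sub>M i\<in>UNIV. P)"
    using indep distr indep_vars_iff_distr_eq_PiM[of UNIV X "\<lambda>_. borel"] by simp
  interpret product_prob_space "\<lambda>_. P" "UNIV :: nat set"
    using P by (intro product_prob_spaceI)
  interpret sequence_space P ..
  have "AE x in distr M (\<Pi>\<^sub>M i\<in>UNIV. borel) (\<lambda>\<omega>. \<lambda>i\<in>UNIV. X i \<omega>).
      (\<lambda>n. (\<Sum>i<n. f (x i)) / n) \<longlonglongrightarrow> (\<integral>y. f y \<partial>P)"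
    unfolding * by (rule strong_law[OF f])
  then have "AE \<omega> in M. (\<lambda>n. (\<Sum>i<n. f ((\<lambda>i\<in>UNIV. X i \<omega>) i)) / n) \<longlonglongrightarrow> (\<integral>y. f y \<partial>P)"
    by (rule AE_distrD[rotated]) measurable
  then show ?thesis by simp
qed

section \<open>Empirical measures\<close>

lemma sets_empirical_measure [simp, measurable_cong]: "sets (empirical_measure x n) = sets borel"
  by (simp add: empirical_measure_def)

lemma space_empirical_measure [simp]: "space (empirical_measure x n) = UNIV"
  by (simp add: empirical_measure_def)

lemma measurable_uniform_count_measure [measurable]:
  "x \<in> uniform_count_measure A \<rightarrow>\<^sub>M borel"
  by (auto simp: measurable_def space_uniform_count_measure sets_uniform_count_measure)

lemma nn_integral_empirical_measure:
  assumes [measurable]: "f \<in> borel_measurable borel"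
  shows "(\<integral>\<^sup>+y. f y \<partial>empirical_measure x n) = (\<Sum>i<n. ennreal (1 / n) * f (x i))"
  unfolding empirical_measure_def
  by (subst nn_integral_distr)
    (auto simp: uniform_count_measure_def nn_integral_point_measure_finite mult.commute)

lemma integral_empirical_measure:
  fixes f :: "'a::topological_space \<Rightarrow> real"
  assumes [measurable]: "f \<in> borel_measurable borel"
  shows "(\<integral>y. f y \<partial>empirical_measure x n) = (\<Sum>i<n. f (x i)) / n"
  unfolding empirical_measure_def
  by (subst integral_distr)
    (auto simp: uniform_count_measure_def lebesgue_integral_point_measure_finite sum_divide_distrib)

lemma integrable_empirical_measure:
  fixes f :: "'a::topological_space \<Rightarrow> real"
  assumes [measurable]: "f \<in> borel_measurable borel"
  shows "integrable (empirical_measure x n) f"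
  unfolding empirical_measure_def
  by (subst integrable_distr_eq)
    (auto simp: uniform_count_measure_def intro!: integrable_point_measure_finite)

lemma prob_space_empirical_measure: "n > 0 \<Longrightarrow> prob_space (empirical_measure x n)"
  unfolding empirical_measure_def
  by (intro prob_space.prob_space_distr prob_space_uniform_count_measure) auto

text \<open>At \<open>n = 0\<close> the empirical measure is null rather than a probability; the
  halfspace lemmas are stated for finite measures so that every index is covered.\<close>

lemma finite_measure_empirical_measure: "finite_measure (empirical_measure x n)"
proof
  have "emeasure (empirical_measure x n) UNIV = (\<integral>\<^sup>+y. 1 \<partial>empirical_measure x n)"
    by simp
  also have "\<dots> < \<infinity>"
    by (subst nn_integral_empirical_measure) (auto simp: ennreal_mult_less_top of_nat_less_top)
  finally show "emeasure (empirical_measure x n) (space (empirical_measure x n)) \<noteq> \<infinity>" by simp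
qed

text \<open>An open set is an increasing union of finite unions of basis sets. By continuity from
  below one of these already has \<open>P\<close>-mass above \<open>c\<close>, and convergence on
  that one suffices.\<close>

lemma eventually_measure_open_greater:
  fixes Q :: "nat \<Rightarrow> 'a::topological_space measure"
  assumes B: "topological_basis B" "countable B"
    and P: "finite_measure P" "sets P = sets borel"
    and Q: "\<And>n. finite_measure (Q n)" "\<And>n. sets (Q n) = sets borel"
    and conv: "\<And>F. finite F \<Longrightarrow> F \<subseteq> B \<Longrightarrow> (\<lambda>n. measure (Q n) (\<Union>F)) \<longlonglongrightarrow> measure P (\<Union>F)"
    and U: "open U" "c < measure P U"
  shows "\<forall>\<^sub>F n in sequentially. c < measure (Q n) U"
proof -
  interpret P: finite_measure P by fact
  obtain B' where B': "B' \<subseteq> B" "\<Union>B' = U"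
    using B(1) U(1) unfolding topological_basis_def by blast
  \<comment> \<open>Adding the empty set makes the family nonempty, so that it can be enumerated
    even when \<open>U\<close> is empty; it is removed again before \<open>conv\<close> is
    applied.\<close>
  have "countable (insert {} B')" using B' B(2) by (auto dest: countable_subset)
  then have "range (from_nat_into (insert {} B')) = insert {} B'"
    by (intro range_from_nat_into) simp
  then obtain b :: "nat \<Rightarrow> 'a set" where rng: "range b = insert {} B'" by (rule that)
  then have b: "b ` K \<subseteq> insert {} B'" for K by blast
  define A where "A k = \<Union>(b ` {..<k})" for k
  have op: "open V" if "V \<in> insert {} B'" for V
    using that B' B(1) by (auto simp: topological_basis_open)
  have A_open: "open (A k)" for k
    unfolding A_def using b op by (intro open_Union) blast
  have "(\<Union>k. A k) = \<Union>(range b)" by (auto simp: A_def)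
  then have UA: "(\<Union>k. A k) = U" using rng B' by simp
  have "(\<lambda>k. measure P (A k)) \<longlonglongrightarrow> measure P (\<Union>k. A k)"
  proof (rule P.finite_Lim_measure_incseq)
    show "range A \<subseteq> sets P" using A_open P(2) by auto
    show "incseq A" unfolding A_def by (intro monoI Union_mono image_mono) auto
  qed
  then have "\<forall>\<^sub>F k in sequentially. c < measure P (A k)"
    using U(2) unfolding UA by (rule order_tendstoD)
  then obtain k where k: "c < measure P (A k)" by (auto simp: eventually_sequentially)
  have *: "A k = \<Union>(b ` {..<k} - {{}})" unfolding A_def by auto
  have "(\<lambda>n. measure (Q n) (A k)) \<longlonglongrightarrow> measure P (A k)"
    unfolding * using b[of "{..<k}"] B' by (intro conv) auto
  then have "\<forall>\<^sub>F n in sequentially. c < measure (Q n) (A k)"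
    using k by (rule order_tendstoD)
  then show ?thesis
  proof eventually_elim
    case (elim n)
    have "A k \<subseteq> U" using UA by auto
    then have "measure (Q n) (A k) \<le> measure (Q n) U"
      using Q U(1) by (intro finite_measure.finite_measure_mono) auto
    with elim show ?case by simp
  qed
qed

section \<open>Halfspace depth\<close>

text \<open>Increasing in \<open>k\<close>, these exhaust the open halfspace \<open>{y. u \<bullet> (y - x) < 0}\<close>, and each stays inside the halfspaces of all normals near \<open>u\<close>.\<close>
definition truncated_halfspace :: "nat \<Rightarrow> 'a::euclidean_space \<Rightarrow> 'a \<Rightarrow> 'a set" where
  "truncated_halfspace k u x = {y. u \<bullet> (y - x) < - (1 / Suc k) \<and> norm (y - x) < Suc k}"

lemma open_truncated_halfspace: "open (truncated_halfspace k u x)"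
  unfolding truncated_halfspace_def
  by (intro open_Collect_conj open_Collect_less continuous_intros)

text \<open>The radius is the margin \<open>1 / Suc k\<close> divided by the norm bound
  \<open>Suc k\<close>: by Cauchy-Schwarz, tilting the normal by so little cannot use up the
  margin.\<close>

lemma truncated_halfspace_subset:
  assumes "norm (v - u) \<le> 1 / (real (Suc k))\<^sup>2"
  shows "truncated_halfspace k u x \<subseteq> {y. v \<bullet> (y - x) < 0}"
proof
  fix y assume y: "y \<in> truncated_halfspace k u x"
  have "(v - u) \<bullet> (y - x) \<le> norm (v - u) * norm (y - x)" by (rule norm_cauchy_schwarz)
  also have "\<dots> \<le> 1 / (real (Suc k))\<^sup>2 * real (Suc k)"
    using assms y by (intro mult_mono) (auto simp: truncated_halfspace_def)
  also have "\<dots> = 1 / Suc k" by (simp add: power2_eq_square)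
  finally show "y \<in> {y. v \<bullet> (y - x) < 0}"
    using y by (auto simp: truncated_halfspace_def inner_diff_left)
qed

lemma tendsto_measure_truncated_halfspace:
  assumes "finite_measure P" "sets P = sets borel"
  shows "(\<lambda>k. measure P (truncated_halfspace k u x)) \<longlonglongrightarrow> measure P {y. u \<bullet> (y - x) < 0}"
proof -
  interpret finite_measure P by fact
  have "{y. u \<bullet> (y - x) < 0} = (\<Union>k. truncated_halfspace k u x)"
  proof (intro subset_antisym subsetI)
    fix y assume y: "y \<in> {y. u \<bullet> (y - x) < 0}"
    obtain k1 :: nat where k1: "1 / Suc k1 < - (u \<bullet> (y - x))"
      using y nat_approx_posE[of "- (u \<bullet> (y - x))"] by auto
    obtain k2 :: nat where k2: "norm (y - x) < k2" using reals_Archimedean2 by blast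
    have "1 / real (Suc (max k1 k2)) \<le> 1 / Suc k1" by (intro divide_left_mono) auto
    then have "y \<in> truncated_halfspace (max k1 k2) u x"
      using k1 k2 by (auto simp: truncated_halfspace_def)
    then show "y \<in> (\<Union>k. truncated_halfspace k u x)" by blast
  next
    fix y assume "y \<in> (\<Union>k. truncated_halfspace k u x)"
    then show "y \<in> {y. u \<bullet> (y - x) < 0}"
      by (auto simp: truncated_halfspace_def intro: less_trans)
  qed
  moreover have "incseq (\<lambda>k. truncated_halfspace k u x)"
  proof (intro monoI subsetI)
    fix k l :: nat and y assume "k \<le> l" and y: "y \<in> truncated_halfspace k u x"
    then have "1 / real (Suc l) \<le> 1 / Suc k" by (intro divide_left_mono) auto
    with y \<open>k \<le> l\<close> show "y \<in> truncated_halfspace l u x" by (auto simp: truncated_halfspace_def)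
  qed
  ultimately show ?thesis
    using open_truncated_halfspace[of _ u x] assms(2)
    by (simp only:) (intro finite_Lim_measure_incseq, auto)
qed

section \<open>Semicontinuity and measurability of the halfspace depth\<close>

lemma sphere_nonempty: "sphere (0::'a::euclidean_space) 1 \<noteq> {}"
  using norm_Basis[OF SOME_Basis] by (metis empty_iff mem_sphere_0)

lemma bdd_below_halfspace_measure: "bdd_below ((\<lambda>u. measure Q {y. u \<bullet> y \<le> u \<bullet> x}) ` A)"
  by (intro bdd_belowI2[of _ 0]) auto

lemma halfspace_depth_le: "norm u = 1 \<Longrightarrow> halfspace_depth x Q \<le> measure Q {y. u \<bullet> y \<le> u \<bullet> x}"
  unfolding halfspace_depth_def by (intro cINF_lower bdd_below_halfspace_measure) auto

lemma halfspace_depth_nonneg: "0 \<le> halfspace_depth x Q"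
  unfolding halfspace_depth_def using sphere_nonempty by (intro cINF_greatest) auto

lemma halfspace_depth_less_iff:
  "halfspace_depth x Q < c \<longleftrightarrow> (\<exists>u. norm u = 1 \<and> measure Q {y. u \<bullet> y \<le> u \<bullet> x} < c)"
  unfolding halfspace_depth_def
  by (subst cINF_less_iff[OF sphere_nonempty bdd_below_halfspace_measure]) (auto simp: Bex_def)

text \<open>Upper semicontinuity in \<open>x\<close>: slightly larger closed halfspaces decrease to
  the given one, so by continuity from above one of them still has mass below \<open>c\<close>, and
  it contains the halfspaces at all nearby points.\<close>

lemma open_halfspace_measure_less:
  fixes u :: "'a::euclidean_space"
  assumes "finite_measure Q" and sets: "sets Q = sets borel" and u: "norm u = 1"
  shows "open {x. measure Q {y. u \<bullet> y \<le> u \<bullet> x} < c}"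
proof (subst open_dist, intro ballI)
  fix x assume x: "x \<in> {x. measure Q {y. u \<bullet> y \<le> u \<bullet> x} < c}"
  interpret finite_measure Q by fact
  define A where "A k = {y. u \<bullet> y \<le> u \<bullet> x + 1 / Suc k}" for k
  have A: "A k \<in> sets Q" for k unfolding sets A_def by measurable
  have "(\<Inter>k. A k) = {y. u \<bullet> y \<le> u \<bullet> x}"
  proof (intro subset_antisym subsetI)
    fix y assume y: "y \<in> (\<Inter>k. A k)"
    have "u \<bullet> y \<le> u \<bullet> x + e" if e: "0 < e" for e
    proof -
      obtain k where "1 / real (Suc k) < e" using e nat_approx_posE by blast
      with y show ?thesis by (auto simp: A_def intro: order_trans less_imp_le dest!: spec[of _ k])
    qed
    then show "y \<in> {y. u \<bullet> y \<le> u \<bullet> x}" by (auto intro: field_le_epsilon)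
  qed (auto simp: A_def add_increasing2)
  moreover have "decseq A"
  proof (intro antimonoI subsetI)
    fix k l :: nat and y assume "k \<le> l" and y: "y \<in> A l"
    then have "1 / real (Suc l) \<le> 1 / Suc k" by (intro divide_left_mono) auto
    with y show "y \<in> A k" by (auto simp: A_def)
  qed
  ultimately have "(\<lambda>k. measure Q (A k)) \<longlonglongrightarrow> measure Q {y. u \<bullet> y \<le> u \<bullet> x}"
    using A finite_Lim_measure_decseq[of A] by auto
  then have "\<forall>\<^sub>F k in sequentially. measure Q (A k) < c" using x by (intro order_tendstoD) auto
  then obtain k where k: "measure Q (A k) < c" by (auto simp: eventually_sequentially)
  show "\<exists>e>0. \<forall>z. dist z x < e \<longrightarrow> z \<in> {x. measure Q {y. u \<bullet> y \<le> u \<bullet> x} < c}"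
  proof (intro exI[of _ "1 / real (Suc k)"] conjI allI impI)
    fix z assume "dist z x < 1 / real (Suc k)"
    moreover have "u \<bullet> (z - x) \<le> norm u * norm (z - x)" by (rule norm_cauchy_schwarz)
    ultimately have "{y. u \<bullet> y \<le> u \<bullet> z} \<subseteq> A k"
      using u by (auto simp: A_def dist_norm inner_diff_right)
    then have "measure Q {y. u \<bullet> y \<le> u \<bullet> z} \<le> measure Q (A k)" by (intro finite_measure_mono A)
    with k show "z \<in> {x. measure Q {y. u \<bullet> y \<le> u \<bullet> x} < c}" by simp
  qed simp
qed

lemma borel_measurable_halfspace_measure:
  fixes u :: "'a::euclidean_space"
  assumes "finite_measure Q" "sets Q = sets borel" "norm u = 1"
  shows "(\<lambda>x. measure Q {y. u \<bullet> y \<le> u \<bullet> x}) \<in> borel_measurable borel"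
  unfolding borel_measurable_iff_less space_borel
  using open_halfspace_measure_less[OF assms] by (intro allI borel_open) simp

text \<open>The infimum runs over uncountably many directions; measurability survives because a
  union of open sublevel sets is open.\<close>

lemma borel_measurable_halfspace_depth:
  assumes "finite_measure Q" "sets Q = sets borel"
  shows "(\<lambda>x. halfspace_depth x Q) \<in> borel_measurable borel"
proof (subst borel_measurable_iff_less, intro allI)
  fix c
  have "{x \<in> space borel. halfspace_depth x Q < c} = (\<Union>u\<in>sphere 0 1. {x. measure Q {y. u \<bullet> y \<le> u \<bullet> x} < c})"
    by (auto simp: halfspace_depth_less_iff)
  also have "open \<dots>" using open_halfspace_measure_less[OF assms] by (intro open_UN) auto
  finally show "{x \<in> space borel. halfspace_depth x Q < c} \<in> sets borel" by (rule borel_open)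
qed

text \<open>As the boundary hyperplane is null, the open part of each halfspace at \<open>x\<close>
  has mass above \<open>c\<close>, and so has some truncation of it, which serves a whole ball of
  directions. Finitely many such balls cover the sphere, leaving finitely many open sets to
  control.\<close>

lemma eventually_halfspace_depth_ge:
  fixes Q :: "nat \<Rightarrow> 'a::euclidean_space measure"
  assumes P: "finite_measure P" "sets P = sets borel"
    and hyperplane: "\<And>u c. u \<noteq> 0 \<Longrightarrow> measure P {y. u \<bullet> y = c} = 0"
    and Q: "\<And>n. finite_measure (Q n)" "\<And>n. sets (Q n) = sets borel"
    and liminf: "\<And>U c. open U \<Longrightarrow> c < measure P U \<Longrightarrow> \<forall>\<^sub>F n in sequentially. c < measure (Q n) U"
    and c: "c < halfspace_depth x P"
  shows "\<forall>\<^sub>F n in sequentially. c \<le> halfspace_depth x (Q n)"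
proof -
  interpret P: finite_measure P by fact
  have "\<exists>k. c < measure P (truncated_halfspace k u x)" if u: "norm u = 1" for u
  proof -
    have "{y. u \<bullet> y \<le> u \<bullet> x} = {y. u \<bullet> (y - x) < 0} \<union> {y. u \<bullet> y = u \<bullet> x}"
      by (auto simp: inner_diff_right)
    moreover have "measure P ({y. u \<bullet> (y - x) < 0} \<union> {y. u \<bullet> y = u \<bullet> x}) \<le>
        measure P {y. u \<bullet> (y - x) < 0} + measure P {y. u \<bullet> y = u \<bullet> x}"
      unfolding P(2) by (intro measure_Un_le) (auto simp: P(2))
    ultimately have "c < measure P {y. u \<bullet> (y - x) < 0}"
      using c u halfspace_depth_le[OF u, of x P] hyperplane[of u "u \<bullet> x"] by fastforce
    then have "\<forall>\<^sub>F k in sequentially. c < measure P (truncated_halfspace k u x)"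
      by (rule order_tendstoD[OF tendsto_measure_truncated_halfspace[OF P]])
    then show ?thesis by (auto simp: eventually_sequentially)
  qed
  then obtain k where k: "\<And>u. norm u = 1 \<Longrightarrow> c < measure P (truncated_halfspace (k u) u x)"
    by metis
  let ?r = "\<lambda>u. 1 / (real (Suc (k u)))\<^sup>2"
  obtain D where D: "finite D" "D \<subseteq> sphere 0 1" "sphere 0 1 \<subseteq> (\<Union>u\<in>D. ball u (?r u))"
    by (rule compactE_image[OF compact_sphere, of "sphere 0 1" "\<lambda>u. ball u (?r u)" 0 1]) auto
  have "\<forall>\<^sub>F n in sequentially. \<forall>u\<in>D. c < measure (Q n) (truncated_halfspace (k u) u x)"
    using D by (intro eventually_ball_finite ballI liminf open_truncated_halfspace k) auto
  then show ?thesis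
  proof eventually_elim
    case (elim n)
    interpret Q: finite_measure "Q n" by (rule Q)
    show ?case
      unfolding halfspace_depth_def
    proof (intro cINF_greatest sphere_nonempty)
      fix v :: 'a assume v: "v \<in> sphere 0 1"
      with D obtain u where u: "u \<in> D" "v \<in> ball u (?r u)" by blast
      then have "truncated_halfspace (k u) u x \<subseteq> {y. v \<bullet> (y - x) < 0}"
        by (intro truncated_halfspace_subset) (auto simp: dist_norm norm_minus_commute)
      also have "\<dots> \<subseteq> {y. v \<bullet> y \<le> v \<bullet> x}" by (auto simp: inner_diff_right)
      finally have "measure (Q n) (truncated_halfspace (k u) u x) \<le> measure (Q n) {y. v \<bullet> y \<le> v \<bullet> x}"
        using Q by (intro Q.finite_measure_mono) auto
      with elim u show "c \<le> measure (Q n) {y. v \<bullet> y \<le> v \<bullet> x}" by fastforce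
    qed
  qed
qed

lemma sigma_halfspace_le_liminf:
  fixes Q :: "nat \<Rightarrow> 'a::euclidean_space measure"
  assumes P: "finite_measure P" "sets P = sets borel"
    and hyperplane: "\<And>u c. u \<noteq> 0 \<Longrightarrow> measure P {y. u \<bullet> y = c} = 0"
    and Q: "\<And>n. finite_measure (Q n)" "\<And>n. sets (Q n) = sets borel"
    and liminf: "\<And>U c. open U \<Longrightarrow> c < measure P U \<Longrightarrow> \<forall>\<^sub>F n in sequentially. c < measure (Q n) U"
  shows "sigma_halfspace P \<le> liminf (\<lambda>n. sigma_halfspace (Q n))"
proof -
  have "ennreal (halfspace_depth x P) \<le> liminf (\<lambda>n. ennreal (halfspace_depth x (Q n)))" for x
  proof (subst le_Liminf_iff, intro allI impI)
    fix y assume y: "y < ennreal (halfspace_depth x P)"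
    then obtain c where c: "y = ennreal c" "0 \<le> c" by (cases y) auto
    then have "c < halfspace_depth x P" using y by (simp add: ennreal_less_iff)
    \<comment> \<open>The pointwise bound on the empirical depth is only weak, so an intermediate
      value restores strictness.\<close>
    then obtain c' where c': "c < c'" "c' < halfspace_depth x P" using dense by blast
    have "\<forall>\<^sub>F n in sequentially. c' \<le> halfspace_depth x (Q n)"
      using eventually_halfspace_depth_ge[OF assms c'(2)] .
    then show "\<forall>\<^sub>F n in sequentially. y < ennreal (halfspace_depth x (Q n))"
      by eventually_elim (use c c' in \<open>auto simp: ennreal_less_iff\<close>)
  qed
  then have "sigma_halfspace P \<le> (\<integral>\<^sup>+x. liminf (\<lambda>n. ennreal (halfspace_depth x (Q n))) \<partial>lborel)"
    unfolding sigma_halfspace_def by (intro nn_integral_mono)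
  also have "\<dots> \<le> liminf (\<lambda>n. sigma_halfspace (Q n))"
    unfolding sigma_halfspace_def
    using borel_measurable_halfspace_depth[OF Q] by (intro nn_integral_liminf) auto
  finally show ?thesis .
qed

text \<open>The complement of a closed halfspace is open, and its mass is lower semicontinuous in
  the direction by truncation. A dense direction close to a nearly optimal one is therefore nearly
  optimal too; this makes a countable, hence measurable, choice possible.\<close>

lemma halfspace_depth_approx_dense:
  fixes T :: "nat \<Rightarrow> 'a::euclidean_space"
  assumes Q: "finite_measure Q" "sets Q = sets borel"
    and T: "sphere 0 1 \<subseteq> closure (range T)" and c: "halfspace_depth x Q < c"
  shows "\<exists>k. measure Q {y. T k \<bullet> y \<le> T k \<bullet> x} < c"
proof -
  interpret finite_measure Q by fact
  have sp: "space Q = UNIV" using Q(2) sets_eq_imp_space_eq by fastforce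
  have compl: "measure Q {y. v \<bullet> y \<le> v \<bullet> x} = measure Q UNIV - measure Q {y. - v \<bullet> (y - x) < 0}" for v
  proof -
    have "UNIV - {y. - v \<bullet> (y - x) < 0} = {y. v \<bullet> y \<le> v \<bullet> x}" by (auto simp: inner_diff_right)
    then show ?thesis
      using finite_measure_compl[of "{y. - v \<bullet> (y - x) < 0}"] sp Q(2) by simp
  qed
  obtain u where u: "norm u = 1" "measure Q {y. u \<bullet> y \<le> u \<bullet> x} < c"
    using c by (auto simp: halfspace_depth_less_iff)
  then have "\<forall>\<^sub>F k in sequentially. measure Q UNIV - c < measure Q (truncated_halfspace k (- u) x)"
    by (intro order_tendstoD[OF tendsto_measure_truncated_halfspace[OF Q]]) (simp add: compl)
  then obtain k where k: "measure Q UNIV - c < measure Q (truncated_halfspace k (- u) x)"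
    by (auto simp: eventually_sequentially)
  have "u \<in> closure (range T)" using u T by auto
  then obtain j where j: "dist (T j) u < 1 / (real (Suc k))\<^sup>2"
    unfolding closure_approachable by (auto dest!: spec[of _ "1 / (real (Suc k))\<^sup>2"])
  then have "truncated_halfspace k (- u) x \<subseteq> {y. - T j \<bullet> (y - x) < 0}"
    by (intro truncated_halfspace_subset) (auto simp: dist_norm norm_minus_commute)
  then have "measure Q (truncated_halfspace k (- u) x) \<le> measure Q {y. - T j \<bullet> (y - x) < 0}"
    using Q(2) by (intro finite_measure_mono) auto
  with k have "measure Q {y. T j \<bullet> y \<le> T j \<bullet> x} < c" unfolding compl by linarith
  then show ?thesis ..
qed

text \<open>
  A nearly optimal halfspace for \<open>P\<close> at each point \<open>x\<close>, chosen measurably, bounds the depth with respect to every \<open>Q\<close>. Hence \<open>sigma_halfspace Q\<close> is at most a linear functional of \<open>Q\<close>, to which the strong law applies.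
\<close>
lemma sigma_halfspace_le_linear:
  fixes P :: "'a::euclidean_space measure"
  assumes P: "finite_measure P" "sets P = sets borel" and e: "0 < e"
  obtains g where "g \<in> borel_measurable borel" "(\<integral>\<^sup>+y. g y \<partial>P) \<le> sigma_halfspace P + ennreal e"
    "\<And>Q. finite_measure Q \<Longrightarrow> sets Q = sets borel \<Longrightarrow> sigma_halfspace Q \<le> (\<integral>\<^sup>+y. g y \<partial>Q)"
proof -
  obtain T0 where T0: "countable T0" "T0 \<subseteq> sphere (0::'a) 1" "sphere 0 1 \<subseteq> closure T0"
    using separable[of "sphere (0::'a) 1"] by blast
  have T0_ne: "T0 \<noteq> {}" using T0(3) sphere_nonempty[where 'a='a] by auto
  define T where "T = from_nat_into T0"
  have T: "norm (T k) = 1" for k using from_nat_into[OF T0_ne, of k] T0(2) by (auto simp: T_def)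
  have T_dense: "sphere 0 1 \<subseteq> closure (range T)"
    using T0(3) range_from_nat_into[OF T0_ne T0(1)] by (simp add: T_def)
  \<comment> \<open>Lebesgue measure is infinite, so a constant slack at every point would have
    infinite integral. The slack \<open>h\<close> is a strictly positive integrable function scaled
    to total at most \<open>e\<close>; the denominator \<open>I + 1\<close> is positive without
    knowing that \<open>I\<close> is.\<close>
  obtain h0 :: "'a \<Rightarrow> ennreal" where h0: "h0 \<in> borel_measurable lborel"
    "integral\<^sup>N lborel h0 \<noteq> \<infinity>" "\<And>x. 0 < h0 x" "\<And>x. h0 x < \<infinity>"
    using sigma_finite_measure.Ex_finite_integrable_function[OF sigma_finite_lborel] by auto
  define I where "I = enn2real (integral\<^sup>N lborel h0)"
  have I: "integral\<^sup>N lborel h0 = ennreal I" "0 \<le> I" using h0(2) by (auto simp: I_def less_top)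
  define h where "h x = e / (I + 1) * enn2real (h0 x)" for x
  have h_meas [measurable]: "h \<in> borel_measurable borel" using h0(1) unfolding h_def by simp
  have h_pos: "0 < h x" for x
    using h0(3,4)[of x] e I(2) by (auto simp: h_def enn2real_positive_iff)
  have "ennreal (h x) = ennreal (e / (I + 1)) * h0 x" for x
    unfolding h_def using e I(2) h0(4)[of x] by (subst ennreal_mult) (simp_all add: less_top)
  then have "(\<integral>\<^sup>+x. ennreal (h x) \<partial>lborel) = (\<integral>\<^sup>+x. ennreal (e / (I + 1)) * h0 x \<partial>lborel)"
    by simp
  also have "\<dots> = ennreal (e / (I + 1) * I)"
    using h0(1) e I by (subst nn_integral_cmult) (auto simp: ennreal_mult[symmetric])
  also have "\<dots> \<le> ennreal e" using e I(2) by (intro ennreal_leI) (auto simp: field_simps)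
  finally have h_int: "(\<integral>\<^sup>+x. ennreal (h x) \<partial>lborel) \<le> ennreal e" .
  note dm [measurable] = borel_measurable_halfspace_depth[OF P]
  have [measurable]: "(\<lambda>x. measure P {y. T k \<bullet> y \<le> T k \<bullet> x}) \<in> borel_measurable borel" for k
    using borel_measurable_halfspace_measure[OF P T] .
  let ?near = "\<lambda>k x. measure P {y. T k \<bullet> y \<le> T k \<bullet> x} < halfspace_depth x P + h x"
  \<comment> \<open>Taking the least admissible index turns the choice of a direction into a
    measurable function of \<open>x\<close>.\<close>
  define K where "K x = (LEAST k. ?near k x)" for x
  have near: "?near (K x) x" for x
    unfolding K_def
    by (rule LeastI_ex, rule halfspace_depth_approx_dense[OF P T_dense]) (simp add: h_pos)
  have K [measurable]: "K \<in> borel \<rightarrow>\<^sub>M count_space UNIV"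
    unfolding K_def by measurable
  have TK [measurable]: "(\<lambda>x. T (K x)) \<in> borel_measurable borel"
    by (rule measurable_compose[OF K]) simp
  define G where "G = {p. T (K (fst p)) \<bullet> snd p \<le> T (K (fst p)) \<bullet> fst p}"
  have G [measurable]: "G \<in> sets (borel \<Otimes>\<^sub>M borel)"
  proof -
    have "{p \<in> space (borel \<Otimes>\<^sub>M borel). T (K (fst p)) \<bullet> snd p \<le> T (K (fst p)) \<bullet> fst p} \<in> sets (borel \<Otimes>\<^sub>M borel)"
      by measurable
    then show ?thesis by (simp add: G_def space_pair_measure)
  qed
  define g where "g y = (\<integral>\<^sup>+x. indicator G (x, y) \<partial>lborel)" for y
  have g_eq: "(\<integral>\<^sup>+y. g y \<partial>Q) = (\<integral>\<^sup>+x. ennreal (measure Q {y. T (K x) \<bullet> y \<le> T (K x) \<bullet> x}) \<partial>lborel)"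
    if Q: "finite_measure Q" "sets Q = sets borel" for Q
  proof -
    interpret Q: finite_measure Q by fact
    interpret pair_sigma_finite lborel Q ..
    note [measurable_cong] = Q(2)
    have "(\<integral>\<^sup>+y. g y \<partial>Q) = (\<integral>\<^sup>+x. \<integral>\<^sup>+y. indicator G (x, y) \<partial>Q \<partial>lborel)"
      unfolding g_def by (subst Fubini') (auto simp: split_beta')
    also have "\<dots> = (\<integral>\<^sup>+x. emeasure Q {y. T (K x) \<bullet> y \<le> T (K x) \<bullet> x} \<partial>lborel)"
    proof (intro nn_integral_cong)
      fix x
      have "(\<integral>\<^sup>+y. indicator G (x, y) \<partial>Q) = (\<integral>\<^sup>+y. indicator {y. T (K x) \<bullet> y \<le> T (K x) \<bullet> x} y \<partial>Q)"
        by (intro nn_integral_cong) (auto simp: G_def indicator_def)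
      also have "\<dots> = emeasure Q {y. T (K x) \<bullet> y \<le> T (K x) \<bullet> x}"
        using Q(2) by (intro nn_integral_indicator) auto
      finally show "(\<integral>\<^sup>+y. indicator G (x, y) \<partial>Q) = emeasure Q {y. T (K x) \<bullet> y \<le> T (K x) \<bullet> x}" .
    qed
    finally show ?thesis by (simp add: Q.emeasure_eq_measure)
  qed
  show ?thesis
  proof (rule that[of g])
    show "g \<in> borel_measurable borel"
      unfolding g_def by measurable
    have "ennreal (measure P {y. T (K x) \<bullet> y \<le> T (K x) \<bullet> x}) \<le> ennreal (halfspace_depth x P) + ennreal (h x)" for x
      using near[of x] h_pos[of x] halfspace_depth_nonneg[of x P]
      by (subst ennreal_plus[symmetric]) (auto simp del: ennreal_plus intro!: ennreal_leI)
    then have "(\<integral>\<^sup>+y. g y \<partial>P) \<le> (\<integral>\<^sup>+x. ennreal (halfspace_depth x P) + ennreal (h x) \<partial>lborel)"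
      unfolding g_eq[OF P] by (intro nn_integral_mono)
    also have "\<dots> = sigma_halfspace P + (\<integral>\<^sup>+x. ennreal (h x) \<partial>lborel)"
      unfolding sigma_halfspace_def by (intro nn_integral_add) auto
    also have "\<dots> \<le> sigma_halfspace P + ennreal e"
      using h_int by (intro add_left_mono)
    finally show "(\<integral>\<^sup>+y. g y \<partial>P) \<le> sigma_halfspace P + ennreal e" .
    show "sigma_halfspace Q \<le> (\<integral>\<^sup>+y. g y \<partial>Q)" if Q: "finite_measure Q" "sets Q = sets borel" for Q
      unfolding g_eq[OF Q] sigma_halfspace_def
      by (intro nn_integral_mono ennreal_leI halfspace_depth_le T)
  qed
qed

section \<open>Strong laws for empirical measures and convergence of the integrated halfspace
  depth\<close>

lemma (in prob_space) strong_law_empirical_measure: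
  fixes X :: "nat \<Rightarrow> 'a \<Rightarrow> 'b::topological_space" and f :: "'b \<Rightarrow> real"
  assumes iid: "indep_vars (\<lambda>_. borel) X UNIV" "\<And>i. distr M borel (X i) = P"
    and f: "integrable P f"
  shows "AE \<omega> in M. (\<lambda>n. \<integral>y. f y \<partial>empirical_measure (\<lambda>i. X i \<omega>) n) \<longlonglongrightarrow> (\<integral>y. f y \<partial>P)"
proof -
  have "sets P = sets borel" using iid(2)[of 0] by auto
  then have "f \<in> borel_measurable borel" using f by (auto cong: measurable_cong_sets)
  then show ?thesis
    using strong_law_iid[OF iid f] by (simp add: integral_empirical_measure)
qed

text \<open>A finite integral confines the value infinity to a \<open>P\<close>-null set, which
  almost surely no sample point hits; on that event \<open>f\<close> may be replaced by its real
  part \<open>enn2real\<close>.\<close>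

lemma (in prob_space) strong_law_empirical_measure_nn_integral:
  fixes X :: "nat \<Rightarrow> 'a \<Rightarrow> 'b::topological_space" and f :: "'b \<Rightarrow> ennreal"
  assumes iid: "indep_vars (\<lambda>_. borel) X UNIV" "\<And>i. distr M borel (X i) = P"
    and f [measurable]: "f \<in> borel_measurable borel" and fin: "(\<integral>\<^sup>+y. f y \<partial>P) \<noteq> \<infinity>"
  shows "AE \<omega> in M. (\<lambda>n. \<integral>\<^sup>+y. f y \<partial>empirical_measure (\<lambda>i. X i \<omega>) n) \<longlonglongrightarrow> (\<integral>\<^sup>+y. f y \<partial>P)"
proof -
  have setsP [measurable_cong]: "sets P = sets borel" using iid(2)[of 0] by auto
  have X [measurable]: "X i \<in> M \<rightarrow>\<^sub>M borel" for i
    using iid(1) by (auto simp: indep_vars_def2)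
  have [measurable]: "f \<in> borel_measurable P" using f setsP by (simp cong: measurable_cong_sets)
  let ?r = "\<lambda>y. enn2real (f y)"
  have AE_fin: "AE y in P. f y \<noteq> \<infinity>"
    using fin by (intro nn_integral_PInf_AE) auto
  have eq: "(\<integral>\<^sup>+y. ennreal (?r y) \<partial>P) = (\<integral>\<^sup>+y. f y \<partial>P)"
    using AE_fin by (intro nn_integral_cong_AE) (auto simp: ennreal_enn2real_if)
  have r: "integrable P ?r"
    using fin by (intro integrableI_nonneg) (auto simp: eq less_top)
  have int_r: "(\<integral>\<^sup>+y. f y \<partial>P) = ennreal (\<integral>y. ?r y \<partial>P)"
    unfolding eq[symmetric] by (intro nn_integral_eq_integral r) auto
  have "AE \<omega> in M. \<forall>i. f (X i \<omega>) \<noteq> \<infinity>"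
    unfolding AE_all_countable
  proof
    fix i
    have "AE y in distr M borel (X i). f y \<noteq> \<infinity>" using AE_fin unfolding iid(2) .
    then show "AE \<omega> in M. f (X i \<omega>) \<noteq> \<infinity>" by (rule AE_distrD[OF X])
  qed
  with strong_law_empirical_measure[OF iid r] show ?thesis
  proof eventually_elim
    case (elim \<omega>)
    have "(\<integral>\<^sup>+y. f y \<partial>empirical_measure (\<lambda>i. X i \<omega>) n)
        = ennreal (\<integral>y. ?r y \<partial>empirical_measure (\<lambda>i. X i \<omega>) n)" for n
    proof -
      have "f (X i \<omega>) = ennreal (?r (X i \<omega>))" for i
        using elim(2) by (auto simp: ennreal_enn2real_if)
      then have "(\<integral>\<^sup>+y. f y \<partial>empirical_measure (\<lambda>i. X i \<omega>) n)
          = (\<integral>\<^sup>+y. ennreal (?r y) \<partial>empirical_measure (\<lambda>i. X i \<omega>) n)"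
        by (simp add: nn_integral_empirical_measure)
      also have "\<dots> = ennreal (\<integral>y. ?r y \<partial>empirical_measure (\<lambda>i. X i \<omega>) n)"
        by (intro nn_integral_eq_integral integrable_empirical_measure) auto
      finally show ?thesis .
    qed
    then show ?case unfolding int_r using elim(1) by (simp add: tendsto_ennrealI)
  qed
qed

text \<open>A countable basis has countably many finite unions, so one null set serves all open sets
  and all \<open>c\<close> at once.\<close>

lemma (in prob_space) AE_measure_empirical_measure_open:
  fixes X :: "nat \<Rightarrow> 'a \<Rightarrow> 'b::second_countable_topology"
  assumes iid: "indep_vars (\<lambda>_. borel) X UNIV" "\<And>i. distr M borel (X i) = P"
  shows "AE \<omega> in M. \<forall>U c. open U \<longrightarrow> c < measure P U \<longrightarrow>
    (\<forall>\<^sub>F n in sequentially. c < measure (empirical_measure (\<lambda>i. X i \<omega>) n) U)"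
proof -
  have X [measurable]: "X i \<in> M \<rightarrow>\<^sub>M borel" for i
    using iid(1) by (auto simp: indep_vars_def2)
  have setsP: "sets P = sets borel" using iid(2)[of 0] by auto
  have "prob_space P" using prob_space_distr[OF X[of 0]] iid(2) by simp
  then interpret P: prob_space P .
  obtain B :: "'b set set" where B: "countable B" "topological_basis B"
    using ex_countable_basis by blast
  let ?F = "{F. finite F \<and> F \<subseteq> B}"
  have "AE \<omega> in M. \<forall>F\<in>?F. (\<lambda>n. measure (empirical_measure (\<lambda>i. X i \<omega>) n) (\<Union>F)) \<longlonglongrightarrow> measure P (\<Union>F)"
  proof (subst AE_ball_countable)
    show "countable ?F" using B(1) by (rule countable_Collect_finite_subset)
    show "\<forall>F\<in>?F. AE \<omega> in M. (\<lambda>n. measure (empirical_measure (\<lambda>i. X i \<omega>) n) (\<Union>F)) \<longlonglongrightarrow> measure P (\<Union>F)"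
    proof
      fix F assume "F \<in> ?F"
      then have "open (\<Union>F)" using B(2) by (intro open_Union) (auto intro: topological_basis_open)
      then have F: "\<Union>F \<in> sets borel" by simp
      then have "integrable P (indicator (\<Union>F) :: 'b \<Rightarrow> real)"
        using setsP by (intro integrable_real_indicator) (auto simp: P.emeasure_eq_measure)
      from strong_law_empirical_measure[OF iid this]
      show "AE \<omega> in M. (\<lambda>n. measure (empirical_measure (\<lambda>i. X i \<omega>) n) (\<Union>F)) \<longlonglongrightarrow> measure P (\<Union>F)"
        using sets_eq_imp_space_eq[OF setsP] by simp
    qed
  qed
  then show ?thesis
  proof eventually_elim
    case (elim \<omega>)
    then show ?case
      using eventually_measure_open_greater[OF B(2,1) P.finite_measure_axioms setsP
          finite_measure_empirical_measure sets_empirical_measure, of "\<lambda>_ i. X i \<omega>" "\<lambda>n. n"]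
      by blast
  qed
qed

lemma (in prob_space) sigma_halfspace_empirical_measure_tendsto:
  fixes X :: "nat \<Rightarrow> 'a \<Rightarrow> 'b::euclidean_space"
  assumes iid: "indep_vars (\<lambda>_. borel) X UNIV" "\<And>i. distr M borel (X i) = P"
    and hyperplane: "\<And>u c. u \<noteq> 0 \<Longrightarrow> measure P {y. u \<bullet> y = c} = 0"
  shows "AE \<omega> in M. (\<lambda>n. sigma_halfspace (empirical_measure (\<lambda>i. X i \<omega>) n)) \<longlonglongrightarrow> sigma_halfspace P"
proof -
  let ?P = "\<lambda>\<omega>. empirical_measure (\<lambda>i. X i \<omega>)"
  have X [measurable]: "X i \<in> M \<rightarrow>\<^sub>M borel" for i
    using iid(1) by (auto simp: indep_vars_def2)
  have setsP: "sets P = sets borel" using iid(2)[of 0] by auto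
  have "prob_space P" using prob_space_distr[OF X[of 0]] iid(2) by simp
  then interpret P: prob_space P .
  have lower: "AE \<omega> in M. sigma_halfspace P \<le> liminf (\<lambda>n. sigma_halfspace (?P \<omega> n))"
    using AE_measure_empirical_measure_open[OF iid]
  proof eventually_elim
    case (elim \<omega>)
    then show ?case
      by (intro sigma_halfspace_le_liminf[OF P.finite_measure_axioms setsP hyperplane]
          finite_measure_empirical_measure sets_empirical_measure) auto
  qed
  show ?thesis
  \<comment> \<open>If the limit is infinite, the lower bound forces it; otherwise the dominating
    function \<open>g\<close> has finite \<open>P\<close>-integral and obeys the strong law.\<close>
  proof (cases "sigma_halfspace P = \<infinity>")
    case True
    from lower show ?thesis
    proof eventually_elim
      case (elim \<omega>)
      then have "liminf (\<lambda>n. sigma_halfspace (?P \<omega> n)) = \<infinity>" using True by (simp add: top_unique)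
      moreover from this have "limsup (\<lambda>n. sigma_halfspace (?P \<omega> n)) = \<infinity>"
        using Liminf_le_Limsup[of sequentially "\<lambda>n. sigma_halfspace (?P \<omega> n)"] by (simp add: top_unique)
      ultimately show ?case unfolding True by (intro Liminf_eq_Limsup) auto
    qed
  next
    case False
    \<comment> \<open>Each slack has its own \<open>g\<close> and its own null set, hence slacks
      from a sequence.\<close>
    have "AE \<omega> in M. \<forall>k. limsup (\<lambda>n. sigma_halfspace (?P \<omega> n)) \<le> sigma_halfspace P + ennreal (1 / Suc k)"
      unfolding AE_all_countable
    proof
      fix k
      obtain g where g: "g \<in> borel_measurable borel"
        "(\<integral>\<^sup>+y. g y \<partial>P) \<le> sigma_halfspace P + ennreal (1 / Suc k)"
        "\<And>Q. finite_measure Q \<Longrightarrow> sets Q = sets borel \<Longrightarrow> sigma_halfspace Q \<le> (\<integral>\<^sup>+y. g y \<partial>Q)"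
        using sigma_halfspace_le_linear[OF P.finite_measure_axioms setsP, of "1 / Suc k"] by auto
      have "(\<integral>\<^sup>+y. g y \<partial>P) \<noteq> \<infinity>"
        using g(2) False by (auto simp: top_unique)
      from strong_law_empirical_measure_nn_integral[OF iid g(1) this]
      show "AE \<omega> in M. limsup (\<lambda>n. sigma_halfspace (?P \<omega> n)) \<le> sigma_halfspace P + ennreal (1 / Suc k)"
      proof eventually_elim
        case (elim \<omega>)
        have "limsup (\<lambda>n. sigma_halfspace (?P \<omega> n)) \<le> limsup (\<lambda>n. \<integral>\<^sup>+y. g y \<partial>?P \<omega> n)"
          by (intro Limsup_mono always_eventually allI g finite_measure_empirical_measure sets_empirical_measure)
        also have "\<dots> = (\<integral>\<^sup>+y. g y \<partial>P)" using elim by (intro lim_imp_Limsup) auto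
        finally show ?case using g(2) by (rule order_trans)
      qed
    qed
    with lower show ?thesis
    proof eventually_elim
      case (elim \<omega>)
      have "(\<lambda>k. sigma_halfspace P + ennreal (1 / Suc k)) \<longlonglongrightarrow> sigma_halfspace P + ennreal 0"
        by (intro tendsto_intros tendsto_ennrealI LIMSEQ_Suc[OF lim_1_over_n])
      then have "limsup (\<lambda>n. sigma_halfspace (?P \<omega> n)) \<le> sigma_halfspace P"
        using elim(2) by (intro LIMSEQ_le_const) auto
      with elim(1) show ?case
        using Liminf_le_Limsup[of sequentially "\<lambda>n. sigma_halfspace (?P \<omega> n)"]
        by (intro Liminf_eq_Limsup) auto
    qed
  qed
qed

section \<open>Simplex volume\<close>

text \<open>A crude form of Hadamard's inequality, from the Leibniz expansion with its n! terms. The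
  factorial cancels against the 1 / n! in the volume of a simplex.\<close>

lemma abs_det_le_prod_norm:
  fixes A :: "real ^ 'n ^ 'n"
  shows "\<bar>det A\<bar> \<le> fact CARD('n) * (\<Prod>i\<in>UNIV. norm (A $ i))"
proof -
  have "\<bar>det A\<bar> \<le> (\<Sum>p\<in>{p. p permutes (UNIV :: 'n set)}. \<Prod>i\<in>UNIV. norm (A $ i))"
    unfolding det_def
  proof (rule sum_abs[THEN order_trans], rule sum_mono)
    fix p
    have "\<bar>of_int (sign p) * (\<Prod>i\<in>UNIV. A $ i $ p i)\<bar> = (\<Prod>i\<in>UNIV. \<bar>A $ i $ p i\<bar>)"
      by (simp add: abs_mult abs_prod sign_def)
    also have "\<dots> \<le> (\<Prod>i\<in>UNIV. norm (A $ i))"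
      by (intro prod_mono) (simp add: component_le_norm_cart)
    finally show "\<bar>of_int (sign p) * (\<Prod>i\<in>UNIV. A $ i $ p i)\<bar> \<le> (\<Prod>i\<in>UNIV. norm (A $ i))" .
  qed
  also have "\<dots> = fact CARD('n) * (\<Prod>i\<in>UNIV. norm (A $ i))"
    by (simp add: card_permutations)
  finally show ?thesis .
qed

lemma measure_convex_hull_few_points:
  fixes S :: "'a::euclidean_space set"
  assumes "finite S" "card S \<le> DIM('a)"
  shows "measure lborel (convex hull S) = 0"
proof -
  have "aff_dim S < DIM('a)" using aff_dim_le_card[OF assms(1)] assms(2) by linarith
  then obtain a b where ab: "a \<noteq> 0" "S \<subseteq> {x. a \<bullet> x = b}"
    by (rule aff_lowdim_subset_hyperplane)
  have "convex hull S \<subseteq> {x. a \<bullet> x = b}"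
    using ab(2) by (intro hull_minimal convex_hyperplane)
  then have "negligible (convex hull S)"
    using negligible_hyperplane[of a b] ab(1) negligible_subset by blast
  moreover have "convex hull S \<in> sets borel"
    using assms(1) by (intro borel_compact finite_imp_compact_convex_hull)
  ultimately show ?thesis
    by (auto simp: negligible_iff_null_sets null_sets_def measure_def)
qed

text \<open>Vertices drawn independently from an empirical measure coincide with positive
  probability, so simplices with repeated vertices must be covered.\<close>

lemma measure_convex_hull_not_inj:
  fixes Y :: "'i \<Rightarrow> 'a::euclidean_space"
  assumes "finite I" "card I = Suc DIM('a)" "\<not> inj_on Y I"
  shows "measure lborel (convex hull (Y ` I)) = 0"
proof (rule measure_convex_hull_few_points)
  have "card (Y ` I) \<noteq> card I" using assms by (auto simp: inj_on_iff_eq_card)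
  then show "card (Y ` I) \<le> DIM('a)" using card_image_le[OF assms(1), of Y] assms(2) by linarith
qed (use assms in auto)

text \<open>The base vertex \<open>k\<close> is left free so that it can be chosen to suit an
  estimate. When vertices repeat, both sides vanish: the matrix has a zero row if the base is
  repeated, and two equal rows otherwise.\<close>

lemma measure_convex_hull_eq_det:
  fixes Y :: "'i \<Rightarrow> real ^ ('n :: {finite, wellorder})"
  assumes I: "finite I" "card I = Suc CARD('n)" "k \<in> I" and f: "bij_betw f UNIV (I - {k})"
  shows "measure lborel (convex hull (Y ` I)) = \<bar>det (\<chi> j. Y (f j) - Y k)\<bar> / fact CARD('n)"
proof -
  let ?A = "\<chi> j. Y (f j) - Y k"
  have tr: "transpose ?A = (\<chi> i. \<chi> j. Y (f j) $ i - Y k $ i)"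
    by (simp add: transpose_def vec_eq_iff)
  have f': "f j \<in> I" "f j \<noteq> k" for j using f by (auto simp: bij_betw_def)
  show ?thesis
  proof (cases "inj_on Y I")
    case True
    have "bij_betw Y (I - {k}) (Y ` (I - {k}))"
      using True by (intro inj_on_imp_bij_betw) (auto intro: inj_on_subset)
    moreover have "Y ` (I - {k}) = Y ` I - {Y k}"
      using True I(3) by (simp add: inj_on_image_set_diff)
    ultimately have bij: "bij_betw (Y \<circ> f) UNIV (Y ` I - {Y k})"
      using bij_betw_trans[OF f] by simp
    have "measure lborel (convex hull (Y ` I)) = \<bar>det (transpose ?A)\<bar> / fact CARD('n)"
      using content_simplex[OF _ _ _ bij] I True unfolding tr by (simp add: card_image)
    then show ?thesis by simp
  next
    case False
    then obtain i j where ij: "i \<in> I" "j \<in> I" "i \<noteq> j" "Y i = Y j" by (auto simp: inj_on_def)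
    have surj: "\<exists>l. f l = m" if "m \<in> I" "m \<noteq> k" for m
    proof -
      from that have "m \<in> f ` UNIV" using f by (simp add: bij_betw_def)
      then show ?thesis by auto
    qed
    have "det ?A = 0"
    proof (cases "i = k \<or> j = k")
      case True
      then obtain m where m: "m \<in> I" "m \<noteq> k" "Y m = Y k" using ij by metis
      then obtain l where "f l = m" using surj by blast
      with m have "row l ?A = 0" by (simp add: row_def vec_eq_iff)
      then show ?thesis by (rule det_zero_row)
    next
      case False
      then obtain l l' where "f l = i" "f l' = j" using ij surj by metis
      with ij have "l \<noteq> l'" "row l ?A = row l' ?A" by (auto simp: row_def vec_eq_iff)
      then show ?thesis by (rule det_identical_rows)
    qed
    then show ?thesis using measure_convex_hull_not_inj[of I Y] I False by simp
  qed
qed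

text \<open>
  Expanding the determinant from the vertex of smallest norm among the others keeps the bound multiplicative in the vertices, so that only first moments are needed.
\<close>
lemma measure_convex_hull_lipschitz_wellorder:
  fixes Y :: "'i \<Rightarrow> real ^ ('n :: {finite, wellorder})"
  assumes I: "finite I" "card I = Suc CARD('n)" "i \<in> I"
  shows "\<bar>measure lborel (convex hull (Y(i := a) ` I)) - measure lborel (convex hull (Y(i := b) ` I))\<bar>
    \<le> 2 ^ CARD('n) * norm (a - b) * (\<Prod>j\<in>I - {i}. 1 + norm (Y j))"
proof -
  have "card (I - {i}) = CARD('n)" using I by simp
  then have "I - {i} \<noteq> {}" by (metis card.empty zero_less_card_finite less_irrefl)
  moreover have "finite (I - {i})" using I by simp
  ultimately obtain k where k: "k \<in> I - {i}" "\<And>j. j \<in> I - {i} \<Longrightarrow> norm (Y k) \<le> norm (Y j)"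
    using arg_min_if_finite(1)[of "I - {i}" "\<lambda>j. norm (Y j)"] arg_min_least[of "I - {i}" _ "\<lambda>j. norm (Y j)"]
    by blast
  have "card (I - {k}) = CARD('n)" using I k by simp
  then obtain f :: "'n \<Rightarrow> 'i" where f: "bij_betw f UNIV (I - {k})"
    using I by (metis finite_Diff finite_same_card_bij finite)
  then have inj: "inj f" and rng: "range f = I - {k}" by (auto simp: bij_betw_def)
  obtain c where c: "f c = i" using rng I(3) k(1) by (metis DiffE DiffI rangeE singletonD singletonI)
  have fc: "f j = i \<longleftrightarrow> j = c" for j using c inj by (auto dest: injD)
  define R where "R v = (\<chi> j. if j = c then v else Y (f j) - Y k)" for v
  have vol: "measure lborel (convex hull (Y(i := v) ` I)) = \<bar>det (R (v - Y k))\<bar> / fact CARD('n)" for v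
  proof -
    have "(\<chi> j. (Y(i := v)) (f j) - (Y(i := v)) k) = R (v - Y k)"
      using k(1) by (auto simp: R_def vec_eq_iff fc)
    then show ?thesis using measure_convex_hull_eq_det[OF I(1,2) _ f, of "Y(i := v)"] k(1) by auto
  qed
  \<comment> \<open>Only row \<open>c\<close> involves the moving vertex, and the determinant is
    additive in that row, so the difference of the two determinants is again a determinant, with row
    \<open>a - b\<close>.\<close>
  have "a - b + (b - Y k) = a - Y k" by simp
  then have "det (R (a - Y k)) = det (R (a - b)) + det (R (b - Y k))"
    using det_row_add[of c "\<lambda>_. a - b" "\<lambda>_. b - Y k" "\<lambda>j. Y (f j) - Y k"] by (simp only: R_def)
  then have "\<bar>measure lborel (convex hull (Y(i := a) ` I)) - measure lborel (convex hull (Y(i := b) ` I))\<bar>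
      \<le> \<bar>det (R (a - b))\<bar> / fact CARD('n)"
    unfolding vol diff_divide_distrib[symmetric] by (simp add: divide_right_mono)
  also have "\<dots> \<le> (\<Prod>j\<in>UNIV. norm (R (a - b) $ j))"
    using abs_det_le_prod_norm[of "R (a - b)"] by (simp add: field_simps)
  also have "\<dots> = norm (a - b) * (\<Prod>j\<in>UNIV - {c}. norm (Y (f j) - Y k))"
    by (subst prod.remove[of _ c]) (auto simp: R_def intro!: prod.cong)
  also have "(\<Prod>j\<in>UNIV - {c}. norm (Y (f j) - Y k)) \<le> (\<Prod>j\<in>UNIV - {c}. 2 * (1 + norm (Y (f j))))"
  proof (intro prod_mono conjI)
    fix j assume j: "j \<in> UNIV - {c}"
    then have "f j \<in> I - {i}" using rng fc by blast
    then have "norm (Y k) \<le> norm (Y (f j))" by (rule k(2))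
    then show "norm (Y (f j) - Y k) \<le> 2 * (1 + norm (Y (f j)))"
      using norm_triangle_ineq4[of "Y (f j)" "Y k"] by simp
  qed simp
  also have "\<dots> = 2 ^ (CARD('n) - 1) * (\<Prod>j\<in>f ` (UNIV - {c}). 1 + norm (Y j))"
    using inj_on_subset[OF inj subset_UNIV]
    by (subst prod.distrib) (simp add: prod.reindex card_Diff_singleton)
  \<comment> \<open>The product on the left omits the base vertex \<open>k\<close>, whose factor is
    at least 1.\<close>
  also have "\<dots> \<le> 2 ^ CARD('n) * (\<Prod>j\<in>I - {i}. 1 + norm (Y j))"
  proof (intro mult_mono)
    show "(\<Prod>j\<in>f ` (UNIV - {c}). 1 + norm (Y j)) \<le> (\<Prod>j\<in>I - {i}. 1 + norm (Y j))"
      using rng fc I(1) by (intro prod_mono2) (auto simp: add_nonneg_nonneg)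
  qed (auto intro!: power_increasing prod_nonneg add_nonneg_nonneg)
  finally show ?thesis by (simp add: mult_left_mono mult.assoc mult.left_commute)
qed

text \<open>
  The volume formula for simplices is available only for well-ordered index types. Every finite type has a copy with a well-order, and the resulting relabelling of coordinates is a linear isometry.
\<close>
typedef 'a well_ordered = "UNIV :: 'a set" ..

lemma bij_Rep_well_ordered: "bij Rep_well_ordered"
proof (rule bijI')
  show "\<exists>x. y = Rep_well_ordered x" for y :: 'a
    using Abs_well_ordered_inverse[of y] by (metis UNIV_I)
qed (rule Rep_well_ordered_inject)

instance well_ordered :: (finite) finite
proof
  have "finite (UNIV :: 'a set)" by simp
  then show "finite (UNIV :: 'a well_ordered set)"
    using bij_betw_finite[OF bij_Rep_well_ordered] by blast
qed

instantiation well_ordered :: (finite) wellorder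
begin

definition less_eq_well_ordered :: "'a well_ordered \<Rightarrow> 'a well_ordered \<Rightarrow> bool" where
  "x \<le> y \<longleftrightarrow> to_nat (Rep_well_ordered x) \<le> to_nat (Rep_well_ordered y)"

definition less_well_ordered :: "'a well_ordered \<Rightarrow> 'a well_ordered \<Rightarrow> bool" where
  "x < y \<longleftrightarrow> to_nat (Rep_well_ordered x) < to_nat (Rep_well_ordered y)"

instance
proof
  fix P :: "'a well_ordered \<Rightarrow> bool" and a
  assume "\<And>x. (\<And>y. y < x \<Longrightarrow> P y) \<Longrightarrow> P x"
  then show "P a"
  proof (induction "to_nat (Rep_well_ordered a)" arbitrary: a rule: less_induct)
    case less
    show ?case
      by (rule less.prems) (auto simp: less_well_ordered_def intro: less.hyps less.prems)
  qed
qed (auto simp: less_eq_well_ordered_def less_well_ordered_def Rep_well_ordered_inject)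

end

definition relabel :: "real ^ 'n \<Rightarrow> real ^ 'n well_ordered" where
  "relabel x = (\<chi> i. x $ Rep_well_ordered i)"

lemma linear_relabel: "linear relabel"
  by (auto simp: relabel_def vec_eq_iff intro!: linearI)

lemma borel_measurable_relabel [measurable]: "relabel \<in> borel_measurable borel"
  by (intro borel_measurable_continuous_onI linear_continuous_on linear_conv_bounded_linear[THEN iffD1] linear_relabel)

lemma bij_relabel: "bij (relabel :: real ^ 'n \<Rightarrow> _)"
proof (rule bijI)
  show "inj (relabel :: real ^ 'n \<Rightarrow> _)"
    unfolding inj_def relabel_def vec_eq_iff
    by (metis Abs_well_ordered_inverse UNIV_I vec_lambda_beta)
  show "surj (relabel :: real ^ 'n \<Rightarrow> _)"
  proof (rule surjI)
    show "relabel (\<chi> i. y $ Abs_well_ordered i) = y" for y :: "real ^ 'n well_ordered"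
      by (simp add: relabel_def vec_eq_iff Rep_well_ordered_inverse)
  qed
qed

lemma inj_relabel: "inj (relabel :: real ^ 'n \<Rightarrow> _)"
  using bij_relabel by (rule bij_is_inj)

lemma inner_relabel: "relabel x \<bullet> relabel y = x \<bullet> y"
  unfolding inner_vec_def relabel_def
  using sum.reindex_bij_betw[OF bij_Rep_well_ordered, of "\<lambda>i. x $ i \<bullet> y $ i"] by simp

lemma norm_relabel: "norm (relabel x) = norm x"
  by (simp add: norm_eq_sqrt_inner inner_relabel)

lemma Basis_real_vec: "(Basis :: (real ^ 'n) set) = range (\<lambda>i. axis i 1)"
  by (auto simp: Basis_vec_def)

lemma relabel_Basis: "relabel ` Basis = Basis"
proof -
  have axis: "relabel (axis i 1) = axis (Abs_well_ordered i) 1" for i :: 'a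
  proof -
    have "Rep_well_ordered j = i \<longleftrightarrow> j = Abs_well_ordered i" for j
      using Abs_well_ordered_inverse[of i] Rep_well_ordered_inverse[of j] by auto
    then show ?thesis by (simp add: relabel_def axis_def vec_eq_iff)
  qed
  have surj: "range (Abs_well_ordered :: 'a \<Rightarrow> _) = UNIV"
    using Rep_well_ordered_inverse by (rule surjI)
  have "relabel ` Basis = (\<lambda>j. axis j 1) ` range (Abs_well_ordered :: 'a \<Rightarrow> _)"
    unfolding Basis_real_vec image_image axis ..
  then show ?thesis unfolding surj Basis_real_vec .
qed

text \<open>Lebesgue measure is determined by its values on boxes, and matching the two bases
  preserves boxes and their side lengths.\<close>

lemma distr_relabel: "distr lborel borel (relabel :: real ^ 'n \<Rightarrow> _) = lborel"
proof (rule lborel_eqI[symmetric])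
  fix l u :: "real ^ 'n well_ordered"
  assume le: "\<And>b. b \<in> Basis \<Longrightarrow> l \<bullet> b \<le> u \<bullet> b"
  obtain l' u' where lu: "l = relabel l'" "u = relabel u'" using bij_relabel by (metis bij_pointE)
  have B: "(\<forall>b\<in>Basis. P b) \<longleftrightarrow> (\<forall>b\<in>Basis. P (relabel b))" for P :: "real ^ 'n well_ordered \<Rightarrow> bool"
    unfolding relabel_Basis[symmetric] by simp
  have "relabel -` box l u = box l' u'"
    by (simp add: box_def lu B inner_relabel vimage_def)
  moreover have "\<forall>b\<in>Basis. l' \<bullet> b \<le> u' \<bullet> b" using le B[of "\<lambda>b. l \<bullet> b \<le> u \<bullet> b"] by (auto simp: lu inner_relabel)
  moreover have "(\<Prod>b\<in>Basis. (u' - l') \<bullet> b) = (\<Prod>b\<in>Basis. (u - l) \<bullet> b)"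
    unfolding relabel_Basis[symmetric] using inj_on_subset[OF inj_relabel subset_UNIV]
    by (subst prod.reindex) (auto simp: lu inner_diff_left inner_relabel)
  ultimately show "emeasure (distr lborel borel relabel) (box l u) = ennreal (\<Prod>b\<in>Basis. (u - l) \<bullet> b)"
    by (simp add: emeasure_distr emeasure_lborel_box_eq)
qed simp

lemma measure_convex_hull_relabel:
  fixes Y :: "'i \<Rightarrow> real ^ 'n"
  assumes "finite I"
  shows "measure lborel (convex hull ((\<lambda>j. relabel (Y j)) ` I)) = measure lborel (convex hull (Y ` I))"
proof -
  have "convex hull ((\<lambda>j. relabel (Y j)) ` I) = relabel ` (convex hull (Y ` I))"
    by (simp add: convex_hull_linear_image[OF linear_relabel] image_image)
  then have "relabel -` (convex hull ((\<lambda>j. relabel (Y j)) ` I)) = convex hull (Y ` I)"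
    by (simp add: inj_vimage_image_eq inj_relabel)
  moreover have "convex hull ((\<lambda>j. relabel (Y j)) ` I) \<in> sets borel"
    using assms by (intro borel_compact finite_imp_compact_convex_hull) auto
  ultimately show ?thesis
    by (subst distr_relabel[symmetric], subst measure_distr) auto
qed

lemma measure_convex_hull_lipschitz:
  fixes Y :: "'i \<Rightarrow> real ^ 'n"
  assumes I: "finite I" "card I = Suc CARD('n)" "i \<in> I"
  shows "\<bar>measure lborel (convex hull (Y(i := a) ` I)) - measure lborel (convex hull (Y(i := b) ` I))\<bar>
    \<le> 2 ^ CARD('n) * norm (a - b) * (\<Prod>j\<in>I - {i}. 1 + norm (Y j))"
proof -
  have card: "CARD('n well_ordered) = CARD('n)"
    using bij_Rep_well_ordered by (rule bij_betw_same_card)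
  have eq: "measure lborel (convex hull (Y(i := v) ` I)) =
      measure lborel (convex hull ((\<lambda>j. relabel (Y j))(i := relabel v) ` I))" for v
  proof -
    have "(\<lambda>j. relabel (Y j))(i := relabel v) = (\<lambda>j. relabel ((Y(i := v)) j))" by auto
    then show ?thesis using measure_convex_hull_relabel[OF I(1), of "Y(i := v)"] by simp
  qed
  have "norm (relabel a - relabel b) = norm (a - b)"
    by (metis linear_diff linear_relabel norm_relabel)
  then show ?thesis
    unfolding eq using measure_convex_hull_lipschitz_wellorder[of I i "\<lambda>j. relabel (Y j)" "relabel a" "relabel b"] I
    by (simp add: card norm_relabel)
qed

text \<open>Moving vertex \<open>i\<close> onto vertex \<open>k\<close> collapses the simplex, so
  the Lipschitz bound becomes a bound on the volume. With \<open>k\<close> of least norm, the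
  distance moved is at most \<open>2 * (1 + norm (Y i))\<close>, which supplies the missing factor
  and the additional 2.\<close>

lemma measure_convex_hull_le:
  fixes Y :: "'i \<Rightarrow> real ^ 'n"
  assumes I: "finite I" "card I = Suc CARD('n)"
  shows "measure lborel (convex hull (Y ` I)) \<le> 2 ^ Suc CARD('n) * (\<Prod>j\<in>I. 1 + norm (Y j))"
proof -
  have "I \<noteq> {}" using I by auto
  then obtain k where k: "k \<in> I" "\<And>j. j \<in> I \<Longrightarrow> norm (Y k) \<le> norm (Y j)"
    using arg_min_if_finite(1)[of I "\<lambda>j. norm (Y j)"] arg_min_least[of I _ "\<lambda>j. norm (Y j)"] I(1)
    by blast
  have "card (I - {k}) = CARD('n)" using I k by simp
  then have "I - {k} \<noteq> {}" by (metis card.empty zero_less_card_finite less_irrefl)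
  then obtain i where i: "i \<in> I" "i \<noteq> k" by blast
  have "\<not> inj_on (Y(i := Y k)) I" using i k(1) by (auto dest: inj_onD[of _ _ i k])
  then have "measure lborel (convex hull (Y(i := Y k) ` I)) = 0"
    using I by (intro measure_convex_hull_not_inj) auto
  then have "measure lborel (convex hull (Y ` I)) \<le> 2 ^ CARD('n) * norm (Y i - Y k) * (\<Prod>j\<in>I - {i}. 1 + norm (Y j))"
    using measure_convex_hull_lipschitz[OF I i(1), of Y "Y i" "Y k"] by (simp add: fun_upd_triv)
  also have "\<dots> \<le> 2 ^ CARD('n) * (2 * (1 + norm (Y i))) * (\<Prod>j\<in>I - {i}. 1 + norm (Y j))"
    using norm_triangle_ineq4[of "Y i" "Y k"] k(2)[OF i(1)]
    by (intro mult_right_mono mult_left_mono prod_nonneg) (auto simp: add_nonneg_nonneg)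
  also have "\<dots> = 2 ^ Suc CARD('n) * (\<Prod>j\<in>I. 1 + norm (Y j))"
    using I(1) i(1) by (simp add: prod.remove[of I i])
  finally show ?thesis .
qed

section \<open>A uniform law of large numbers for Lipschitz functions\<close>

text \<open>Given the Lipschitz condition, the growth bound amounts to
  \<open>\<bar>f 0\<bar> \<le> 1\<close>; it is kept explicit because \<open>1 + norm\<close> is the
  integrable envelope that controls the tails.\<close>

definition growth_lipschitz :: "('a::real_normed_vector \<Rightarrow> real) set" where
  "growth_lipschitz = {f. (\<forall>y. \<bar>f y\<bar> \<le> 1 + norm y) \<and> (\<forall>y z. \<bar>f y - f z\<bar> \<le> norm (y - z))}"

lemma borel_measurable_growth_lipschitz:
  fixes f :: "'a::euclidean_space \<Rightarrow> real"
  assumes "f \<in> growth_lipschitz"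
  shows "f \<in> borel_measurable borel"
proof -
  have "1-lipschitz_on UNIV f"
    using assms by (intro lipschitz_onI) (auto simp: growth_lipschitz_def dist_norm)
  then show ?thesis
    by (intro borel_measurable_continuous_onI lipschitz_on_continuous_on)
qed

text \<open>
  The function \<open>q\<close> labels the cells of a partition of the space, \<open>d k\<close> is near every point of the cell \<open>k\<close>, and all but finitely many cells carry little of the first moment.
\<close>
lemma growth_lipschitz_uniform:
  fixes Q :: "nat \<Rightarrow> 'a::euclidean_space measure" and q :: "'a \<Rightarrow> nat"
  assumes P: "prob_space P" "sets P = sets borel" "integrable P (\<lambda>y. 1 + norm y)"
    and Q: "\<And>n. n > 0 \<Longrightarrow> prob_space (Q n)" "\<And>n. sets (Q n) = sets borel" "\<And>n. integrable (Q n) (\<lambda>y. 1 + norm y)"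
    and q: "q \<in> borel \<rightarrow>\<^sub>M count_space UNIV" "\<And>y. norm (y - d (q y)) \<le> \<delta>" and \<delta>: "0 < \<delta>"
    and cells: "\<And>k. (\<lambda>n. measure (Q n) {y. q y = k}) \<longlonglongrightarrow> measure P {y. q y = k}"
    and tails: "\<And>N. (\<lambda>n. \<integral>y. indicator {y. N \<le> q y} y * (1 + norm y) \<partial>Q n)
      \<longlonglongrightarrow> (\<integral>y. indicator {y. N \<le> q y} y * (1 + norm y) \<partial>P)"
  shows "\<forall>\<^sub>F n in sequentially. \<forall>f\<in>growth_lipschitz. \<bar>(\<integral>y. f y \<partial>Q n) - (\<integral>y. f y \<partial>P)\<bar> \<le> 5 * \<delta>"
proof -
  interpret P: prob_space P by fact
  note [measurable] = q(1)
  let ?t = "\<lambda>N y. indicator {y. N \<le> q y} y * (1 + norm y)"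
  have "(\<lambda>N. \<integral>y. ?t N y \<partial>P) \<longlonglongrightarrow> (\<integral>y. 0 \<partial>P)"
  proof (rule integral_dominated_convergence)
    show "AE y in P. (\<lambda>N. ?t N y) \<longlonglongrightarrow> 0"
    proof (rule AE_I2)
      fix y
      have "\<forall>\<^sub>F N in sequentially. ?t N y = 0"
        using eventually_gt_at_top[of "q y"] by eventually_elim simp
      then show "(\<lambda>N. ?t N y) \<longlonglongrightarrow> 0" by (rule tendsto_eventually)
    qed
    have "?t N \<in> borel_measurable borel" for N by measurable
    then show "?t N \<in> borel_measurable P" for N using P(2) by (simp cong: measurable_cong_sets)
    show "AE y in P. norm (?t N y) \<le> 1 + norm y" for N by (auto simp: indicator_def)
  qed (use P(3) in auto)
  then have "\<forall>\<^sub>F N in sequentially. (\<integral>y. ?t N y \<partial>P) < \<delta>"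
    using \<delta> by (intro order_tendstoD) auto
  then obtain N where N: "(\<integral>y. ?t N y \<partial>P) < \<delta>" by (auto simp: eventually_sequentially)
  \<comment> \<open>The weight \<open>1 + norm (d k)\<close> dominates
    \<open>\<bar>f (d k)\<bar>\<close> for every \<open>f\<close> in the class, so the threshold for
    \<open>n\<close> is chosen before \<open>f\<close>.\<close>
  have "(\<lambda>n. \<Sum>k<N. (1 + norm (d k)) * \<bar>measure (Q n) {y. q y = k} - measure P {y. q y = k}\<bar>)
      \<longlonglongrightarrow> (\<Sum>k<N. (1 + norm (d k)) * \<bar>measure P {y. q y = k} - measure P {y. q y = k}\<bar>)"
    by (intro tendsto_intros cells)
  then have "\<forall>\<^sub>F n in sequentially. (\<Sum>k<N. (1 + norm (d k)) * \<bar>measure (Q n) {y. q y = k} - measure P {y. q y = k}\<bar>) < \<delta>"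
    using \<delta> by (intro order_tendstoD) auto
  moreover have "\<forall>\<^sub>F n in sequentially. (\<integral>y. ?t N y \<partial>Q n) < \<delta>"
    using order_tendstoD(2)[OF tails N] .
  ultimately show ?thesis using eventually_gt_at_top[of 0]
  proof eventually_elim
    case (elim n)
    show ?case
    proof
      fix f :: "'a \<Rightarrow> real" assume f: "f \<in> growth_lipschitz"
      note fm [measurable] = borel_measurable_growth_lipschitz[OF f]
      have f_bound: "\<bar>f y\<bar> \<le> 1 + norm y" and f_lip: "\<bar>f y - f z\<bar> \<le> norm (y - z)" for y z
        using f by (auto simp: growth_lipschitz_def)
      \<comment> \<open>A step function: the value of \<open>f\<close> at the cell's representative
        on the first \<open>N\<close> cells, zero on the tail.\<close>
      define s where "s y = (\<Sum>k<N. f (d k) * indicator {y. q y = k} y)" for y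
      have s_eq: "s y = (if q y < N then f (d (q y)) else 0)" for y
        unfolding s_def by (simp add: indicator_def)
      have rem: "\<bar>f y - s y\<bar> \<le> \<delta> + ?t N y" for y
        using f_bound[of y] f_lip[of y "d (q y)"] q(2)[of y] \<delta>
        by (auto simp: s_eq indicator_def)
      have approx: "\<bar>(\<integral>y. f y \<partial>R) - (\<Sum>k<N. f (d k) * measure R {y. q y = k})\<bar> \<le> \<delta> + (\<integral>y. ?t N y \<partial>R)"
        if R: "prob_space R" "sets R = sets borel" "integrable R (\<lambda>y. 1 + norm y)" for R
      proof -
        interpret R: prob_space R by fact
        have mR: "g \<in> borel_measurable borel \<Longrightarrow> g \<in> borel_measurable R" for g :: "'a \<Rightarrow> real"
          using R(2) by (simp cong: measurable_cong_sets)
        have spR: "space R = UNIV" using sets_eq_imp_space_eq[OF R(2)] by simp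
        have intf: "integrable R f"
          by (rule Bochner_Integration.integrable_bound[OF R(3) mR[OF fm]]) (use f_bound in simp)
        have ind: "integrable R (\<lambda>y. f (d k) * indicator {y. q y = k} y)" for k
          by (intro integrable_mult_right integrable_real_indicator) (auto simp: R.emeasure_eq_measure R(2))
        have ints: "integrable R s" unfolding s_def by (intro Bochner_Integration.integrable_sum ind)
        have intt: "integrable R (?t N)"
        proof (rule Bochner_Integration.integrable_bound[OF R(3)])
          show "?t N \<in> borel_measurable R" by (rule mR) measurable
        qed (auto simp: indicator_def)
        have "(\<integral>y. s y \<partial>R) = (\<Sum>k<N. f (d k) * measure R {y. q y = k})"
          unfolding s_def by (subst Bochner_Integration.integral_sum[OF ind]) (simp add: spR)
        then have "(\<integral>y. f y \<partial>R) - (\<Sum>k<N. f (d k) * measure R {y. q y = k}) = (\<integral>y. f y - s y \<partial>R)"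
          using Bochner_Integration.integral_diff[OF intf ints] by simp
        also have "\<bar>\<dots>\<bar> \<le> (\<integral>y. \<bar>f y - s y\<bar> \<partial>R)" by (rule integral_abs_bound)
        also have "\<dots> \<le> (\<integral>y. \<delta> + ?t N y \<partial>R)"
          using intf ints intt rem by (intro integral_mono) auto
        also have "\<dots> = \<delta> + (\<integral>y. ?t N y \<partial>R)"
          using intt by (simp add: R.prob_space)
        finally show ?thesis .
      qed
      have "\<bar>(\<Sum>k<N. f (d k) * measure (Q n) {y. q y = k}) - (\<Sum>k<N. f (d k) * measure P {y. q y = k})\<bar>
          = \<bar>\<Sum>k<N. f (d k) * (measure (Q n) {y. q y = k} - measure P {y. q y = k})\<bar>"
        by (simp add: sum_subtractf right_diff_distrib)
      also have "\<dots> \<le> (\<Sum>k<N. (1 + norm (d k)) * \<bar>measure (Q n) {y. q y = k} - measure P {y. q y = k}\<bar>)"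
        by (rule sum_abs[THEN order_trans], rule sum_mono) (auto simp: abs_mult intro!: mult_right_mono f_bound)
      \<comment> \<open>The five errors: mesh and tail under \<open>P\<close>, mesh and tail under
        \<open>Q n\<close>, and the discrepancy of the cell masses.\<close>
      finally show "\<bar>(\<integral>y. f y \<partial>Q n) - (\<integral>y. f y \<partial>P)\<bar> \<le> 5 * \<delta>"
        using approx[OF P] approx[OF Q(1)[OF elim(3)] Q(2,3)] elim(1,2) N by linarith
    qed
  qed
qed

text \<open>For each mesh \<open>1 / Suc m\<close> the cells collect the points having the same
  first close point in a dense sequence. Cells and tails over all \<open>m\<close> are countably
  many, so the strong law holds for all of them simultaneously.\<close>

lemma (in prob_space) growth_lipschitz_uniform_law:
  fixes X :: "nat \<Rightarrow> 'a \<Rightarrow> 'b::euclidean_space"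
  assumes iid: "indep_vars (\<lambda>_. borel) X UNIV" "\<And>i. distr M borel (X i) = P"
    and moment: "integrable P norm"
  shows "AE \<omega> in M. \<forall>e>0. \<forall>\<^sub>F n in sequentially. \<forall>f\<in>growth_lipschitz.
    \<bar>(\<integral>y. f y \<partial>empirical_measure (\<lambda>i. X i \<omega>) n) - (\<integral>y. f y \<partial>P)\<bar> \<le> e"
proof -
  let ?P = "\<lambda>\<omega>. empirical_measure (\<lambda>i. X i \<omega>)"
  have X [measurable]: "X i \<in> M \<rightarrow>\<^sub>M borel" for i
    using iid(1) by (auto simp: indep_vars_def2)
  have setsP: "sets P = sets borel" using iid(2)[of 0] by auto
  have "prob_space P" using prob_space_distr[OF X[of 0]] iid(2) by simp
  then interpret P: prob_space P .
  have moment': "integrable P (\<lambda>y. 1 + norm y)" using moment by simp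
  obtain D :: "'b set" where D: "countable D" "UNIV \<subseteq> closure D"
    using separable[of "UNIV :: 'b set"] by auto
  have D_ne: "D \<noteq> {}" using D(2) by auto
  define d where "d = from_nat_into D"
  have rd: "range d = D" unfolding d_def using D(1) D_ne by (rule range_from_nat_into[rotated])
  let ?\<delta> = "\<lambda>m. 1 / real (Suc m)"
  define q where "q m y = (LEAST k. dist (d k) y < ?\<delta> m)" for m y
  have q_dist: "dist (d (q m y)) y < ?\<delta> m" for m y
  proof -
    have "y \<in> closure (range d)" using D(2) rd by auto
    then have "\<exists>k. dist (d k) y < ?\<delta> m"
      unfolding closure_approachable by (auto dest!: spec[of _ "?\<delta> m"])
    then show ?thesis unfolding q_def by (rule LeastI_ex)
  qed
  have qm [measurable]: "q m \<in> borel \<rightarrow>\<^sub>M count_space UNIV" for m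
    unfolding q_def by measurable
  have "AE \<omega> in M. \<forall>m k. (\<lambda>n. measure (?P \<omega> n) {y. q m y = k}) \<longlonglongrightarrow> measure P {y. q m y = k}"
    unfolding AE_all_countable
  proof (intro allI)
    fix m k
    have "{y. q m y = k} \<in> sets P" unfolding setsP by measurable
    then have "integrable P (indicator {y. q m y = k} :: 'b \<Rightarrow> real)"
      by (intro integrable_real_indicator) (auto simp: P.emeasure_eq_measure)
    from strong_law_empirical_measure[OF iid this]
    show "AE \<omega> in M. (\<lambda>n. measure (?P \<omega> n) {y. q m y = k}) \<longlonglongrightarrow> measure P {y. q m y = k}"
      using sets_eq_imp_space_eq[OF setsP] by simp
  qed
  moreover have "AE \<omega> in M. \<forall>m N. (\<lambda>n. \<integral>y. indicator {y. N \<le> q m y} y * (1 + norm y) \<partial>?P \<omega> n)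
      \<longlonglongrightarrow> (\<integral>y. indicator {y. N \<le> q m y} y * (1 + norm y) \<partial>P)"
    unfolding AE_all_countable
  proof (intro allI)
    fix m N
    have "{y. N \<le> q m y} \<in> sets P" unfolding setsP by measurable
    from integrable_mult_indicator[OF this moment']
    have "integrable P (\<lambda>y. indicator {y. N \<le> q m y} y * (1 + norm y))" by simp
    then show "AE \<omega> in M. (\<lambda>n. \<integral>y. indicator {y. N \<le> q m y} y * (1 + norm y) \<partial>?P \<omega> n)
      \<longlonglongrightarrow> (\<integral>y. indicator {y. N \<le> q m y} y * (1 + norm y) \<partial>P)"
      by (rule strong_law_empirical_measure[OF iid])
  qed
  ultimately show ?thesis
  proof eventually_elim
    case (elim \<omega>)
    show ?case
    proof (intro allI impI)
      fix e :: real assume "0 < e"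
      then obtain m where m: "?\<delta> m < e / 5" using nat_approx_posE[of "e / 5"] by auto
      have "\<forall>\<^sub>F n in sequentially. \<forall>f\<in>growth_lipschitz. \<bar>(\<integral>y. f y \<partial>?P \<omega> n) - (\<integral>y. f y \<partial>P)\<bar> \<le> 5 * ?\<delta> m"
      proof (rule growth_lipschitz_uniform[OF P.prob_space_axioms setsP moment'
            prob_space_empirical_measure sets_empirical_measure _ qm])
        show "integrable (?P \<omega> n) (\<lambda>y. 1 + norm y)" for n
          by (intro integrable_empirical_measure) measurable
        show "norm (y - d (q m y)) \<le> ?\<delta> m" for y
          using q_dist[of m y] by (simp add: dist_norm norm_minus_commute)
        show "(\<lambda>n. measure (?P \<omega> n) {y. q m y = k}) \<longlonglongrightarrow> measure P {y. q m y = k}" for k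
          using elim(1) by blast
        show "(\<lambda>n. \<integral>y. indicator {y. N \<le> q m y} y * (1 + norm y) \<partial>?P \<omega> n)
            \<longlonglongrightarrow> (\<integral>y. indicator {y. N \<le> q m y} y * (1 + norm y) \<partial>P)" for N
          using elim(2) by blast
      qed simp_all
      then show "\<forall>\<^sub>F n in sequentially. \<forall>f\<in>growth_lipschitz. \<bar>(\<integral>y. f y \<partial>?P \<omega> n) - (\<integral>y. f y \<partial>P)\<bar> \<le> e"
      proof eventually_elim
        case (elim n)
        moreover have "5 * ?\<delta> m \<le> e" using m by simp
        ultimately show ?case by (meson order_trans)
      qed
    qed
  qed
qed

section \<open>Product integrals of multiplicatively bounded kernels\<close>

text \<open>One constant serves both bounds, so that dividing a section by its constant gives a
  member of \<open>growth_lipschitz\<close>. Measurability refers to \<open>borel\<close>, so that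
  the same kernel can be integrated against every product measure in question.\<close>

definition product_kernel :: "'i set \<Rightarrow> real \<Rightarrow> (('i \<Rightarrow> 'a::euclidean_space) \<Rightarrow> real) \<Rightarrow> bool" where
  "product_kernel I L h \<longleftrightarrow> h \<in> borel_measurable (\<Pi>\<^sub>M i\<in>I. borel) \<and>
    (\<forall>x. \<bar>h x\<bar> \<le> L * (\<Prod>i\<in>I. 1 + norm (x i))) \<and>
    (\<forall>i\<in>I. \<forall>x a b. \<bar>h (x(i := a)) - h (x(i := b))\<bar> \<le> L * norm (a - b) * (\<Prod>j\<in>I - {i}. 1 + norm (x j)))"

lemma product_kernelD:
  assumes "product_kernel I L h"
  shows "h \<in> borel_measurable (\<Pi>\<^sub>M i\<in>I. borel)"
    "\<bar>h x\<bar> \<le> L * (\<Prod>i\<in>I. 1 + norm (x i))"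
    "i \<in> I \<Longrightarrow> \<bar>h (x(i := a)) - h (x(i := b))\<bar> \<le> L * norm (a - b) * (\<Prod>j\<in>I - {i}. 1 + norm (x j))"
  using assms unfolding product_kernel_def by blast+

lemma prod_growth_pos: "0 < (\<Prod>i\<in>I. 1 + norm (x i :: 'a::real_normed_vector))"
  by (intro prod_pos) (simp add: add_pos_nonneg)

lemma
  fixes Q :: "'a::euclidean_space measure"
  assumes Q: "prob_space Q" "sets Q = sets borel" "integrable Q (\<lambda>y. 1 + norm y)" and I: "finite I"
  shows integrable_PiM_bounded:
      "h \<in> borel_measurable (\<Pi>\<^sub>M i\<in>I. Q) \<Longrightarrow> (\<And>x. \<bar>h x\<bar> \<le> C * (\<Prod>i\<in>I. 1 + norm (x i))) \<Longrightarrow>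
        integrable (\<Pi>\<^sub>M i\<in>I. Q) h"
    and integral_PiM_bounded:
      "h \<in> borel_measurable (\<Pi>\<^sub>M i\<in>I. Q) \<Longrightarrow> (\<And>x. \<bar>h x\<bar> \<le> C * (\<Prod>i\<in>I. 1 + norm (x i))) \<Longrightarrow>
        \<bar>\<integral>x. h x \<partial>(\<Pi>\<^sub>M i\<in>I. Q)\<bar> \<le> C * (\<integral>y. 1 + norm y \<partial>Q) ^ card I"
proof -
  interpret Q: prob_space Q by fact
  interpret product_sigma_finite "\<lambda>_. Q" ..
  assume h: "h \<in> borel_measurable (\<Pi>\<^sub>M i\<in>I. Q)" and bound: "\<And>x. \<bar>h x\<bar> \<le> C * (\<Prod>i\<in>I. 1 + norm (x i))"
  have int: "integrable (\<Pi>\<^sub>M i\<in>I. Q) (\<lambda>x. C * (\<Prod>i\<in>I. 1 + norm (x i)))"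
    by (intro integrable_mult_right product_integrable_prod I Q(3))
  then show inth: "integrable (\<Pi>\<^sub>M i\<in>I. Q) h"
    using h by (rule Bochner_Integration.integrable_bound)
      (intro AE_I2, use order_trans[OF bound abs_ge_self] in simp)
  have "\<bar>\<integral>x. h x \<partial>(\<Pi>\<^sub>M i\<in>I. Q)\<bar> \<le> (\<integral>x. \<bar>h x\<bar> \<partial>(\<Pi>\<^sub>M i\<in>I. Q))" by (rule integral_abs_bound)
  also have "\<dots> \<le> (\<integral>x. C * (\<Prod>i\<in>I. 1 + norm (x i)) \<partial>(\<Pi>\<^sub>M i\<in>I. Q))"
    using inth int bound by (intro integral_mono) auto
  also have "\<dots> = C * (\<integral>y. 1 + norm y \<partial>Q) ^ card I"
    using product_integral_prod[OF I, of "\<lambda>_ y. 1 + norm y"] Q(3) by simp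
  finally show "\<bar>\<integral>x. h x \<partial>(\<Pi>\<^sub>M i\<in>I. Q)\<bar> \<le> C * (\<integral>y. 1 + norm y \<partial>Q) ^ card I" .
qed

lemma product_kernel_section:
  assumes j: "finite I" "j \<notin> I" and h: "product_kernel (insert j I) L h"
  shows "\<bar>h (x(j := y))\<bar> \<le> L * (\<Prod>i\<in>I. 1 + norm (x i)) * (1 + norm y)"
    and "\<bar>h (x(j := y)) - h (x(j := z))\<bar> \<le> L * (\<Prod>i\<in>I. 1 + norm (x i)) * norm (y - z)"
proof -
  have "(\<Prod>i\<in>I. 1 + norm ((x(j := y)) i)) = (\<Prod>i\<in>I. 1 + norm (x i))"
    using j by (intro prod.cong) auto
  then show "\<bar>h (x(j := y))\<bar> \<le> L * (\<Prod>i\<in>I. 1 + norm (x i)) * (1 + norm y)"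
    using product_kernelD(2)[OF h, of "x(j := y)"] j by (simp add: mult_ac)
  show "\<bar>h (x(j := y)) - h (x(j := z))\<bar> \<le> L * (\<Prod>i\<in>I. 1 + norm (x i)) * norm (y - z)"
    using product_kernelD(3)[OF h, of j x y z] j by (simp add: mult_ac)
qed

text \<open>The class is stable under integrating out a variable: the factor
  \<open>1 + norm y\<close> splits off both bounds and its mean is absorbed into the
  constant.\<close>

lemma product_kernel_partial_integral:
  fixes P :: "'a::euclidean_space measure"
  assumes P: "prob_space P" "sets P = sets borel" "integrable P (\<lambda>y. 1 + norm y)"
    and j: "finite I" "j \<notin> I" and h: "product_kernel (insert j I) L h"
  shows "product_kernel I (L * (\<integral>y. 1 + norm y \<partial>P)) (\<lambda>x. \<integral>y. h (x(j := y)) \<partial>P)"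
    and "integrable P (\<lambda>y. h (x(j := y)))"
proof -
  interpret P: prob_space P by fact
  note bound = product_kernel_section(1)[OF j h]
  \<comment> \<open>Here \<open>x\<close> is arbitrary, possibly outside the space of the product
    measure, so the section is measurable by Lipschitz continuity rather than by measurability of
    \<open>h\<close>.\<close>
  have cont: "(\<lambda>y. h (x(j := y))) \<in> borel_measurable borel" for x
  proof -
    have "(L * (\<Prod>k\<in>I. 1 + norm (x k)))-lipschitz_on UNIV (\<lambda>y. h (x(j := y)))"
    proof (rule lipschitz_onI)
      show "0 \<le> L * (\<Prod>k\<in>I. 1 + norm (x k))"
        using order_trans[OF abs_ge_zero bound[of x 0]] by simp
      show "dist (h (x(j := a))) (h (x(j := b))) \<le> L * (\<Prod>k\<in>I. 1 + norm (x k)) * dist a b" for a b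
        unfolding dist_norm real_norm_def by (rule product_kernel_section(2)[OF j h])
    qed
    then show ?thesis by (intro borel_measurable_continuous_onI lipschitz_on_continuous_on)
  qed
  have int: "integrable P (\<lambda>y. h (x(j := y)))" for x
  proof (rule Bochner_Integration.integrable_bound)
    show "integrable P (\<lambda>y. L * (\<Prod>i\<in>I. 1 + norm (x i)) * (1 + norm y))"
      by (intro integrable_mult_right P(3))
    show "(\<lambda>y. h (x(j := y))) \<in> borel_measurable P" using cont P(2) by (simp cong: measurable_cong_sets)
    show "AE y in P. norm (h (x(j := y))) \<le> norm (L * (\<Prod>i\<in>I. 1 + norm (x i)) * (1 + norm y))"
      using order_trans[OF bound abs_ge_self] by (intro AE_I2) simp
  qed
  then show "integrable P (\<lambda>y. h (x(j := y)))" .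
  show "product_kernel I (L * (\<integral>y. 1 + norm y \<partial>P)) (\<lambda>x. \<integral>y. h (x(j := y)) \<partial>P)"
    unfolding product_kernel_def
  proof (intro conjI ballI allI)
    have [measurable]: "h \<in> borel_measurable (\<Pi>\<^sub>M i\<in>insert j I. borel)" by (rule product_kernelD(1)[OF h])
    have "(\<lambda>(x, y). h (x(j := y))) \<in> borel_measurable ((\<Pi>\<^sub>M i\<in>I. borel) \<Otimes>\<^sub>M borel)"
      by measurable
    moreover have "sets ((\<Pi>\<^sub>M i\<in>I. (borel :: 'a measure)) \<Otimes>\<^sub>M borel) = sets ((\<Pi>\<^sub>M i\<in>I. borel) \<Otimes>\<^sub>M P)"
      using P(2) by (intro sets_pair_measure_cong) auto
    ultimately have "(\<lambda>(x, y). h (x(j := y))) \<in> borel_measurable ((\<Pi>\<^sub>M i\<in>I. borel) \<Otimes>\<^sub>M P)"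
      using measurable_cong_sets by blast
    then show "(\<lambda>x. \<integral>y. h (x(j := y)) \<partial>P) \<in> borel_measurable (\<Pi>\<^sub>M i\<in>I. borel)"
      by (rule P.borel_measurable_lebesgue_integral)
  next
    fix x
    have "\<bar>\<integral>y. h (x(j := y)) \<partial>P\<bar> \<le> (\<integral>y. \<bar>h (x(j := y))\<bar> \<partial>P)" by (rule integral_abs_bound)
    also have "\<dots> \<le> (\<integral>y. L * (\<Prod>i\<in>I. 1 + norm (x i)) * (1 + norm y) \<partial>P)"
      using bound int P(3) by (intro integral_mono integrable_mult_right integrable_abs) auto
    also have "\<dots> = L * (\<Prod>i\<in>I. 1 + norm (x i)) * (\<integral>y. 1 + norm y \<partial>P)"
      by (rule integral_mult_right_zero)
    finally show "\<bar>\<integral>y. h (x(j := y)) \<partial>P\<bar> \<le> L * (\<integral>y. 1 + norm y \<partial>P) * (\<Prod>i\<in>I. 1 + norm (x i))"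
      by (simp add: mult_ac)
  next
    fix i x a b assume i: "i \<in> I"
    then have "i \<noteq> j" using j by auto
    have lip: "\<bar>h (x(i := a, j := y)) - h (x(i := b, j := y))\<bar>
        \<le> L * norm (a - b) * (\<Prod>k\<in>I - {i}. 1 + norm (x k)) * (1 + norm y)" for y
    proof -
      have "insert j I - {i} = insert j (I - {i})" using \<open>i \<noteq> j\<close> by auto
      moreover have "(\<Prod>k\<in>I - {i}. 1 + norm ((x(j := y)) k)) = (\<Prod>k\<in>I - {i}. 1 + norm (x k))"
        using j by (intro prod.cong) auto
      ultimately have "(\<Prod>k\<in>insert j I - {i}. 1 + norm ((x(j := y)) k)) = (1 + norm y) * (\<Prod>k\<in>I - {i}. 1 + norm (x k))"
        using j by (simp add: prod.insert)
      then show ?thesis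
        using product_kernelD(3)[OF h, of i "x(j := y)" a b] i \<open>i \<noteq> j\<close>
        by (simp add: fun_upd_twist mult_ac)
    qed
    have "\<bar>(\<integral>y. h (x(i := a, j := y)) \<partial>P) - (\<integral>y. h (x(i := b, j := y)) \<partial>P)\<bar>
        = \<bar>\<integral>y. h (x(i := a, j := y)) - h (x(i := b, j := y)) \<partial>P\<bar>"
      by (subst Bochner_Integration.integral_diff[OF int int]) simp
    also have "\<dots> \<le> (\<integral>y. \<bar>h (x(i := a, j := y)) - h (x(i := b, j := y))\<bar> \<partial>P)"
      by (rule integral_abs_bound)
    also have "\<dots> \<le> (\<integral>y. L * norm (a - b) * (\<Prod>k\<in>I - {i}. 1 + norm (x k)) * (1 + norm y) \<partial>P)"
      using lip int P(3)
      by (intro integral_mono integrable_mult_right integrable_abs Bochner_Integration.integrable_diff) auto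
    also have "\<dots> = L * norm (a - b) * (\<Prod>k\<in>I - {i}. 1 + norm (x k)) * (\<integral>y. 1 + norm y \<partial>P)"
      by (rule integral_mult_right_zero)
    finally show "\<bar>(\<integral>y. h (x(i := a, j := y)) \<partial>P) - (\<integral>y. h (x(i := b, j := y)) \<partial>P)\<bar>
        \<le> L * (\<integral>y. 1 + norm y \<partial>P) * norm (a - b) * (\<Prod>k\<in>I - {i}. 1 + norm (x k))"
      by (simp add: mult_ac)
  qed
qed

text \<open>
  Integrating out one variable at a time, each section of the kernel is a multiple of a function to which the uniform law applies.
\<close>
lemma product_kernel_integral_tendsto:
  fixes Q :: "nat \<Rightarrow> 'a::euclidean_space measure"
  assumes P: "prob_space P" "sets P = sets borel" "integrable P (\<lambda>y. 1 + norm y)"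
    and Q: "\<And>n. n > 0 \<Longrightarrow> prob_space (Q n)" "\<And>n. sets (Q n) = sets borel" "\<And>n. integrable (Q n) (\<lambda>y. 1 + norm y)"
    and moment: "(\<lambda>n. \<integral>y. 1 + norm y \<partial>Q n) \<longlonglongrightarrow> (\<integral>y. 1 + norm y \<partial>P)"
    and uniform: "\<And>e. 0 < e \<Longrightarrow> \<forall>\<^sub>F n in sequentially. \<forall>f\<in>growth_lipschitz.
      \<bar>(\<integral>y. f y \<partial>Q n) - (\<integral>y. f y \<partial>P)\<bar> \<le> e"
    and I: "finite I" and h: "product_kernel I L h" and L: "0 < L"
  shows "(\<lambda>n. \<integral>x. h x \<partial>(\<Pi>\<^sub>M i\<in>I. Q n)) \<longlonglongrightarrow> (\<integral>x. h x \<partial>(\<Pi>\<^sub>M i\<in>I. P))"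
  using I h L
proof (induction I arbitrary: h L)
  case empty
  have "(\<integral>x. h x \<partial>(\<Pi>\<^sub>M i\<in>{}. R)) = h (\<lambda>_. undefined)" for R :: "'a measure"
    by (simp add: PiM_empty lebesgue_integral_count_space_finite)
  then show ?case by simp
next
  case (insert j I)
  interpret P: prob_space P by fact
  interpret PP: product_sigma_finite "\<lambda>_. P" ..
  let ?m = "\<lambda>R. \<integral>y. 1 + norm y \<partial>R"
  let ?g = "\<lambda>R x. \<integral>y. h (x(j := y)) \<partial>R"
  note h = insert.prems(1)
  have meas: "f \<in> borel_measurable (\<Pi>\<^sub>M i\<in>K. R)" if "f \<in> borel_measurable (\<Pi>\<^sub>M i\<in>K. borel)" "sets R = sets borel"
    for R :: "'a measure" and K and f :: "_ \<Rightarrow> real"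
    using that sets_PiM_cong[of K K "\<lambda>_. R" "\<lambda>_. borel"] by (simp cong: measurable_cong_sets)
  have m_pos: "0 < ?m P"
  proof -
    have "(\<integral>y. 1 \<partial>P) \<le> ?m P" using P(3) by (intro integral_mono) auto
    then show ?thesis by (simp add: P.prob_space)
  qed
  have kernel: "product_kernel I (L * ?m R) (?g R)" and int_sec: "\<And>x. integrable R (\<lambda>y. h (x(j := y)))"
    if "prob_space R" "sets R = sets borel" "integrable R (\<lambda>y. 1 + norm y)" for R
    by (rule product_kernel_partial_integral[OF that insert.hyps h])+
  have iter: "(\<integral>x. h x \<partial>(\<Pi>\<^sub>M i\<in>insert j I. R)) = (\<integral>x. ?g R x \<partial>(\<Pi>\<^sub>M i\<in>I. R))"
    if R: "prob_space R" "sets R = sets borel" "integrable R (\<lambda>y. 1 + norm y)" for R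
  proof -
    interpret R: prob_space R by fact
    interpret product_sigma_finite "\<lambda>_. R" ..
    have "finite (insert j I)" using insert.hyps by simp
    then have "integrable (\<Pi>\<^sub>M i\<in>insert j I. R) h"
      by (rule integrable_PiM_bounded[OF R _ meas[OF product_kernelD(1)[OF h] R(2)] product_kernelD(2)[OF h]])
    then show ?thesis by (rule product_integral_insert[OF insert.hyps])
  qed
  \<comment> \<open>The integral under \<open>Q n\<close> is split in two: with \<open>P\<close> in
    the inner integral the kernel \<open>?g P\<close> is fixed and the induction hypothesis applies;
    exchanging \<open>Q n\<close> for \<open>P\<close> inside is handled by
    \<open>diff\<close>.\<close>
  have main: "(\<lambda>n. \<integral>x. ?g P x \<partial>(\<Pi>\<^sub>M i\<in>I. Q n)) \<longlonglongrightarrow> (\<integral>x. ?g P x \<partial>(\<Pi>\<^sub>M i\<in>I. P))"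
    by (rule insert.IH[OF kernel[OF P] mult_pos_pos[OF insert.prems(2) m_pos]])
  have diff: "(\<lambda>n. (\<integral>x. ?g (Q n) x \<partial>(\<Pi>\<^sub>M i\<in>I. Q n)) - (\<integral>x. ?g P x \<partial>(\<Pi>\<^sub>M i\<in>I. Q n))) \<longlonglongrightarrow> 0"
  proof (rule LIMSEQ_I)
    fix r :: real assume r: "0 < r"
    \<comment> \<open>Eventually the mean of \<open>1 + norm\<close> under \<open>Q n\<close> is
      below \<open>?m P + 1\<close>, so \<open>?C\<close> bounds \<open>L\<close> times the product
      moment, and \<open>e * ?C\<close> is half of \<open>r\<close>.\<close>
    let ?C = "L * (?m P + 1) ^ card I"
    have C: "0 < ?C" using insert.prems(2) m_pos by simp
    define e where "e = r / (2 * ?C)"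
    have e: "0 < e" "e * ?C < r" using r C by (auto simp: e_def field_simps)
    have "\<forall>\<^sub>F n in sequentially. ?m (Q n) < ?m P + 1"
      using order_tendstoD(2)[OF moment] by simp
    with uniform[OF e(1)] eventually_gt_at_top[of 0]
    have "\<forall>\<^sub>F n in sequentially.
      norm ((\<integral>x. ?g (Q n) x \<partial>(\<Pi>\<^sub>M i\<in>I. Q n)) - (\<integral>x. ?g P x \<partial>(\<Pi>\<^sub>M i\<in>I. Q n)) - 0) < r"
    proof eventually_elim
      case (elim n)
      note Qn = Q(1)[OF elim(2)] Q(2,3)[of n]
      interpret Qn: prob_space "Q n" by fact
      have m_nonneg: "0 \<le> ?m (Q n)" by (intro integral_nonneg_AE AE_I2) simp
      have close: "\<bar>?g (Q n) x - ?g P x\<bar> \<le> e * L * (\<Prod>i\<in>I. 1 + norm (x i))" for x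
      proof -
        let ?c = "L * (\<Prod>i\<in>I. 1 + norm (x i))"
        have c: "0 < ?c" using insert.prems(2) prod_growth_pos[of x I] by simp
        have "(\<lambda>y. h (x(j := y)) / ?c) \<in> growth_lipschitz"
          unfolding growth_lipschitz_def
        proof (intro CollectI conjI allI)
          fix y
          have "\<bar>h (x(j := y))\<bar> \<le> ?c * (1 + norm y)"
            by (rule product_kernel_section(1)[OF insert.hyps h])
          then show "\<bar>h (x(j := y)) / ?c\<bar> \<le> 1 + norm y"
            using c by (simp add: abs_divide divide_le_eq mult.commute)
        next
          fix y z
          have "\<bar>h (x(j := y)) - h (x(j := z))\<bar> \<le> ?c * norm (y - z)"
            by (rule product_kernel_section(2)[OF insert.hyps h])
          then show "\<bar>h (x(j := y)) / ?c - h (x(j := z)) / ?c\<bar> \<le> norm (y - z)"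
            unfolding diff_divide_distrib[symmetric] using c by (simp add: abs_divide divide_le_eq mult.commute)
        qed
        then have "\<bar>(\<integral>y. h (x(j := y)) / ?c \<partial>Q n) - (\<integral>y. h (x(j := y)) / ?c \<partial>P)\<bar> \<le> e"
          using elim(1) by blast
        then have "\<bar>(?g (Q n) x - ?g P x) / ?c\<bar> \<le> e" by (simp add: diff_divide_distrib)
        then show ?thesis using c by (simp add: abs_divide divide_le_eq mult_ac)
      qed
      have "integrable (\<Pi>\<^sub>M i\<in>I. Q n) (?g R)" if R: "prob_space R" "sets R = sets borel" "integrable R (\<lambda>y. 1 + norm y)" for R
        by (rule integrable_PiM_bounded[OF Qn insert.hyps(1)
              meas[OF product_kernelD(1)[OF kernel[OF R]] Qn(2)] product_kernelD(2)[OF kernel[OF R]]])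
      note int = this[OF Qn] this[OF P]
      have "(\<integral>x. ?g (Q n) x \<partial>(\<Pi>\<^sub>M i\<in>I. Q n)) - (\<integral>x. ?g P x \<partial>(\<Pi>\<^sub>M i\<in>I. Q n)) = (\<integral>x. ?g (Q n) x - ?g P x \<partial>(\<Pi>\<^sub>M i\<in>I. Q n))"
        using int by (rule Bochner_Integration.integral_diff[symmetric])
      also have "\<bar>\<dots>\<bar> \<le> e * L * ?m (Q n) ^ card I"
        using Bochner_Integration.integrable_diff[OF int]
        by (intro integral_PiM_bounded[OF Qn insert.hyps(1) _ close] borel_measurable_integrable)
      also have "\<dots> \<le> e * L * (?m P + 1) ^ card I"
        using e(1) insert.prems(2) m_nonneg elim(3) by (intro mult_left_mono power_mono) auto
      finally show ?case using e(2) by (simp add: mult.assoc)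
    qed
    then show "\<exists>n0. \<forall>n\<ge>n0. norm ((\<integral>x. ?g (Q n) x \<partial>(\<Pi>\<^sub>M i\<in>I. Q n)) - (\<integral>x. ?g P x \<partial>(\<Pi>\<^sub>M i\<in>I. Q n)) - 0) < r"
      by (simp add: eventually_sequentially)
  qed
  have "(\<lambda>n. \<integral>x. ?g (Q n) x \<partial>(\<Pi>\<^sub>M i\<in>I. Q n)) \<longlonglongrightarrow> (\<integral>x. h x \<partial>(\<Pi>\<^sub>M i\<in>insert j I. P))"
    using tendsto_add[OF diff main] iter[OF P] by simp
  moreover have "\<forall>\<^sub>F n in sequentially. (\<integral>x. ?g (Q n) x \<partial>(\<Pi>\<^sub>M i\<in>I. Q n)) = (\<integral>x. h x \<partial>(\<Pi>\<^sub>M i\<in>insert j I. Q n))"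
    using eventually_gt_at_top[of 0] by eventually_elim (simp add: iter Q)
  ultimately show ?case by (rule Lim_transform_eventually)
qed

section \<open>Simplicial depth\<close>

text \<open>A point outside the hull is strictly separated from it by some direction. Strict
  separation from finitely many vertices is an open condition on the direction, so a dense set of
  directions detects it.\<close>

lemma mem_convex_hull_iff_dense:
  fixes Y :: "'i \<Rightarrow> 'a::euclidean_space"
  assumes D: "closure D = UNIV" and I: "finite I"
  shows "x \<in> convex hull (Y ` I) \<longleftrightarrow> (\<forall>u\<in>D. \<exists>i\<in>I. u \<bullet> Y i \<le> u \<bullet> x)"
proof
  assume x: "x \<in> convex hull (Y ` I)"
  show "\<forall>u\<in>D. \<exists>i\<in>I. u \<bullet> Y i \<le> u \<bullet> x"
  proof (rule ccontr)
    assume "\<not> ?thesis"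
    then obtain u where "\<And>i. i \<in> I \<Longrightarrow> u \<bullet> x < u \<bullet> Y i" by (auto simp: not_le)
    then have "convex hull (Y ` I) \<subseteq> {y. u \<bullet> y > u \<bullet> x}"
      by (intro hull_minimal convex_halfspace_gt) auto
    with x show False by auto
  qed
next
  assume *: "\<forall>u\<in>D. \<exists>i\<in>I. u \<bullet> Y i \<le> u \<bullet> x"
  show "x \<in> convex hull (Y ` I)"
  proof (rule ccontr)
    assume "x \<notin> convex hull (Y ` I)"
    moreover have "closed (convex hull (Y ` I))"
      using I by (intro compact_imp_closed finite_imp_compact_convex_hull) auto
    ultimately obtain a b where ab: "a \<bullet> x < b" "\<And>y. y \<in> convex hull (Y ` I) \<Longrightarrow> b < a \<bullet> y"
      using separating_hyperplane_closed_point[of "convex hull (Y ` I)" x] by auto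
    let ?U = "\<Inter>i\<in>I. {u. u \<bullet> x < u \<bullet> Y i}"
    have "open ?U"
      using I by (intro open_INT open_Collect_less continuous_intros ballI) auto
    moreover have "a \<in> ?U"
    proof
      fix i assume "i \<in> I"
      then have "Y i \<in> convex hull (Y ` I)" by (intro hull_inc) auto
      with ab show "a \<in> {u. u \<bullet> x < u \<bullet> Y i}" by fastforce
    qed
    ultimately have "?U \<inter> closure D \<noteq> {}" unfolding D by blast
    then have "?U \<inter> D \<noteq> {}" using open_Int_closure_eq_empty[OF \<open>open ?U\<close>] by blast
    then obtain u where "u \<in> D" "\<And>i. i \<in> I \<Longrightarrow> u \<bullet> x < u \<bullet> Y i" by blast
    with * show False by fastforce
  qed
qed

lemma sigma_simplicial_eq_volume:
  fixes Q :: "'a::euclidean_space measure"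
  assumes Q: "prob_space Q" "sets Q = sets borel"
  shows "sigma_simplicial Q = (\<integral>\<^sup>+Y. ennreal (measure lborel (convex hull (Y ` {1..DIM('a) + 1})))
      \<partial>(\<Pi>\<^sub>M i\<in>{1..DIM('a) + 1}. Q))"
    and "(\<lambda>Y. measure lborel (convex hull (Y ` {1..DIM('a) + 1})))
      \<in> borel_measurable (\<Pi>\<^sub>M i\<in>{1..DIM('a) + 1}. Q)"
proof -
  let ?I = "{1..DIM('a) + 1}"
  let ?S = "\<Pi>\<^sub>M i\<in>?I. Q"
  interpret Q: prob_space Q by fact
  interpret S: prob_space ?S by (intro prob_space_PiM Q)
  interpret pair_sigma_finite lborel ?S ..
  obtain D :: "'a set" where D: "countable D" "UNIV \<subseteq> closure D"
    using separable[of "UNIV :: 'a set"] by auto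
  then have cD: "closure D = UNIV" by auto
  have coord: "(\<lambda>p. snd p i) \<in> borel_measurable (lborel \<Otimes>\<^sub>M ?S)" if "i \<in> ?I" for i
  proof -
    have "(\<lambda>p. snd p i) \<in> lborel \<Otimes>\<^sub>M ?S \<rightarrow>\<^sub>M Q" using that by measurable
    then show ?thesis using Q(2) by (simp cong: measurable_cong_sets)
  qed
  \<comment> \<open>Incidence of point and simplex, written through countably many directions to
    make it jointly measurable, as Fubini requires.\<close>
  define G where "G = {p \<in> space (lborel \<Otimes>\<^sub>M ?S). \<forall>u\<in>D. \<exists>i\<in>?I. u \<bullet> snd p i \<le> u \<bullet> (fst p :: 'a)}"
  have G [measurable]: "G \<in> sets (lborel \<Otimes>\<^sub>M ?S)"
    unfolding G_def
  proof (rule sets.sets_Collect_countable_All'[OF _ D(1)], rule sets.sets_Collect_finite_Ex)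
    fix u i assume "i \<in> ?I"
    then have "(\<lambda>p. u \<bullet> snd p i) \<in> borel_measurable (lborel \<Otimes>\<^sub>M ?S)"
      by (intro borel_measurable_inner borel_measurable_const coord)
    moreover have "(\<lambda>p. u \<bullet> (fst p :: 'a)) \<in> borel_measurable (lborel \<Otimes>\<^sub>M ?S)"
      by (intro borel_measurable_inner borel_measurable_const measurable_fst'') simp
    ultimately show "{p \<in> space (lborel \<Otimes>\<^sub>M ?S). u \<bullet> snd p i \<le> u \<bullet> (fst p :: 'a)} \<in> sets (lborel \<Otimes>\<^sub>M ?S)"
      by (rule borel_measurable_le)
  qed simp
  have G_iff: "(x, Y) \<in> G \<longleftrightarrow> x \<in> convex hull (Y ` ?I)" if "Y \<in> space ?S" for x Y
    using that mem_convex_hull_iff_dense[OF cD, of ?I x Y] by (simp add: G_def space_pair_measure)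
  have vol: "(\<integral>\<^sup>+x. indicator G (x, Y) \<partial>lborel) = ennreal (measure lborel (convex hull (Y ` ?I)))"
    if "Y \<in> space ?S" for Y
  proof -
    have c: "compact (convex hull (Y ` ?I))" by (intro finite_imp_compact_convex_hull) simp
    have "(\<integral>\<^sup>+x. indicator G (x, Y) \<partial>lborel) = (\<integral>\<^sup>+x. indicator (convex hull (Y ` ?I)) x \<partial>lborel)"
      using G_iff[OF that] by (intro nn_integral_cong) (auto simp: indicator_def)
    also have "\<dots> = emeasure lborel (convex hull (Y ` ?I))"
      using borel_compact[OF c] by simp
    also have "\<dots> = ennreal (measure lborel (convex hull (Y ` ?I)))"
      using emeasure_compact_finite[OF c] by (intro emeasure_eq_ennreal_measure) auto
    finally show ?thesis .
  qed
  have "sigma_simplicial Q = (\<integral>\<^sup>+x. \<integral>\<^sup>+Y. indicator G (x, Y) \<partial>?S \<partial>lborel)"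
    unfolding sigma_simplicial_def
  proof (intro nn_integral_cong)
    fix x :: 'a
    have eq: "{Y \<in> space ?S. x \<in> convex hull (Y ` ?I)} = Pair x -` G"
      using G_iff by (auto simp: G_def space_pair_measure)
    have "ennreal (simplicial_depth x Q) = emeasure ?S (Pair x -` G)"
      unfolding simplicial_depth_def eq by (rule S.emeasure_eq_measure[symmetric])
    also have "\<dots> = (\<integral>\<^sup>+Y. indicator (Pair x -` G) Y \<partial>?S)"
      by (rule nn_integral_indicator[OF sets_Pair1[OF G], symmetric])
    finally show "ennreal (simplicial_depth x Q) = (\<integral>\<^sup>+Y. indicator G (x, Y) \<partial>?S)"
      by (simp add: indicator_def)
  qed
  also have "\<dots> = (\<integral>\<^sup>+Y. \<integral>\<^sup>+x. indicator G (x, Y) \<partial>lborel \<partial>?S)"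
  proof (rule Fubini'[symmetric])
    show "(\<lambda>(x, Y). indicator G (x, Y) :: ennreal) \<in> borel_measurable (lborel \<Otimes>\<^sub>M ?S)"
      unfolding split_beta' prod.collapse by (rule borel_measurable_indicator[OF G])
  qed
  also have "\<dots> = (\<integral>\<^sup>+Y. ennreal (measure lborel (convex hull (Y ` ?I))) \<partial>?S)"
    by (intro nn_integral_cong vol)
  finally show "sigma_simplicial Q = (\<integral>\<^sup>+Y. ennreal (measure lborel (convex hull (Y ` ?I))) \<partial>?S)" .
  have "(\<lambda>Y. \<integral>\<^sup>+x. indicator G (x, Y) \<partial>lborel) \<in> borel_measurable ?S"
    using G by measurable
  then have "(\<lambda>Y. ennreal (measure lborel (convex hull (Y ` ?I)))) \<in> borel_measurable ?S"
    by (subst (asm) measurable_cong[OF vol])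
  then have "(\<lambda>Y. enn2real (ennreal (measure lborel (convex hull (Y ` ?I))))) \<in> borel_measurable ?S"
    by (rule measurable_compose[OF _ borel_measurable_enn2real]) simp
  then show "(\<lambda>Y. measure lborel (convex hull (Y ` ?I))) \<in> borel_measurable ?S"
    by simp
qed

text \<open>The constant is dictated by the volume bound; the Lipschitz bound holds with half of
  it.\<close>

lemma product_kernel_simplex_volume:
  "product_kernel {1..DIM(real ^ 'm) + 1} (2 ^ Suc CARD('m))
    (\<lambda>Y. measure lborel (convex hull (Y ` {1..DIM(real ^ 'm) + 1}) :: (real ^ 'm) set))"
  unfolding product_kernel_def
proof (intro conjI ballI allI)
  let ?I = "{1..DIM(real ^ 'm) + 1}"
  let ?V = "\<lambda>Y. measure lborel (convex hull (Y ` ?I) :: (real ^ 'm) set)"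
  have card: "finite ?I" "card ?I = Suc CARD('m)" by auto
  \<comment> \<open>Any probability measure on the Borel sets would do: the measurability claim
    depends on its sigma-algebra alone.\<close>
  have "prob_space (return borel (0 :: real ^ 'm))" by (intro prob_space_return) simp
  from sigma_simplicial_eq_volume(2)[OF this]
  have "?V \<in> borel_measurable (\<Pi>\<^sub>M i\<in>?I. return borel 0)" by simp
  moreover have "sets (\<Pi>\<^sub>M i\<in>?I. return borel (0 :: real ^ 'm)) = sets (\<Pi>\<^sub>M i\<in>?I. borel)"
    by (intro sets_PiM_cong) auto
  ultimately show "?V \<in> borel_measurable (\<Pi>\<^sub>M i\<in>?I. borel)"
    using measurable_cong_sets by blast
  show "\<bar>?V Y\<bar> \<le> 2 ^ Suc CARD('m) * (\<Prod>i\<in>?I. 1 + norm (Y i))" for Y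
    using measure_convex_hull_le[OF card, of Y] by simp
  fix i Y and a b :: "real ^ 'm" assume i: "i \<in> ?I"
  have "\<bar>?V (Y(i := a)) - ?V (Y(i := b))\<bar> \<le> 2 ^ CARD('m) * (norm (a - b) * (\<Prod>j\<in>?I - {i}. 1 + norm (Y j)))"
    using measure_convex_hull_lipschitz[OF card i, of Y a b] by (simp only: mult.assoc)
  also have "\<dots> \<le> 2 ^ Suc CARD('m) * (norm (a - b) * (\<Prod>j\<in>?I - {i}. 1 + norm (Y j)))"
    by (intro mult_right_mono mult_nonneg_nonneg less_imp_le[OF prod_growth_pos]) auto
  finally show "\<bar>?V (Y(i := a)) - ?V (Y(i := b))\<bar> \<le> 2 ^ Suc CARD('m) * norm (a - b) * (\<Prod>j\<in>?I - {i}. 1 + norm (Y j))"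
    by (simp only: mult.assoc)
qed

lemma (in prob_space) sigma_simplicial_empirical_measure_tendsto:
  fixes X :: "nat \<Rightarrow> 'a \<Rightarrow> real ^ 'm"
  assumes iid: "indep_vars (\<lambda>_. borel) X UNIV" "\<And>i. distr M borel (X i) = P"
    and moment: "integrable P norm"
  shows "AE \<omega> in M. (\<lambda>n. sigma_simplicial (empirical_measure (\<lambda>i. X i \<omega>) n)) \<longlonglongrightarrow> sigma_simplicial P"
proof -
  let ?P = "\<lambda>\<omega>. empirical_measure (\<lambda>i. X i \<omega>)"
  let ?I = "{1..DIM(real ^ 'm) + 1}"
  let ?V = "\<lambda>Y. measure lborel (convex hull (Y ` ?I) :: (real ^ 'm) set)"
  have X [measurable]: "X i \<in> M \<rightarrow>\<^sub>M borel" for i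
    using iid(1) by (auto simp: indep_vars_def2)
  have setsP: "sets P = sets borel" using iid(2)[of 0] by auto
  have P: "prob_space P" using prob_space_distr[OF X[of 0]] iid(2) by simp
  interpret P: prob_space P by (rule P)
  have moment': "integrable P (\<lambda>y. 1 + norm y)" using moment by simp
  have sigma: "sigma_simplicial Q = ennreal (\<integral>Y. ?V Y \<partial>(\<Pi>\<^sub>M i\<in>?I. Q))"
    if Q: "prob_space Q" "sets Q = sets borel" "integrable Q (\<lambda>y. 1 + norm y)" for Q
  proof -
    have "integrable (\<Pi>\<^sub>M i\<in>?I. Q) ?V"
      by (rule integrable_PiM_bounded[OF Q _ sigma_simplicial_eq_volume(2)[OF Q(1,2)]
            product_kernelD(2)[OF product_kernel_simplex_volume]]) simp
    then show ?thesis
      unfolding sigma_simplicial_eq_volume(1)[OF Q(1,2)] by (intro nn_integral_eq_integral) auto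
  qed
  show ?thesis
    using growth_lipschitz_uniform_law[OF iid moment] strong_law_empirical_measure[OF iid moment']
  proof eventually_elim
    case (elim \<omega>)
    have int: "integrable (?P \<omega> n) (\<lambda>y. 1 + norm y)" for n
      by (intro integrable_empirical_measure) measurable
    have "(\<lambda>n. \<integral>Y. ?V Y \<partial>(\<Pi>\<^sub>M i\<in>?I. ?P \<omega> n)) \<longlonglongrightarrow> (\<integral>Y. ?V Y \<partial>(\<Pi>\<^sub>M i\<in>?I. P))"
      using elim(1)
      by (intro product_kernel_integral_tendsto[OF P setsP moment' prob_space_empirical_measure
            sets_empirical_measure int elim(2) _ _ product_kernel_simplex_volume]) auto
    then have "(\<lambda>n. ennreal (\<integral>Y. ?V Y \<partial>(\<Pi>\<^sub>M i\<in>?I. ?P \<omega> n))) \<longlonglongrightarrow> sigma_simplicial P"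
      unfolding sigma[OF P setsP moment'] by (rule tendsto_ennrealI)
    \<comment> \<open>The identity \<open>sigma\<close> needs a probability measure, so index 0 is
      excluded.\<close>
    moreover have "\<forall>\<^sub>F n in sequentially. ennreal (\<integral>Y. ?V Y \<partial>(\<Pi>\<^sub>M i\<in>?I. ?P \<omega> n)) = sigma_simplicial (?P \<omega> n)"
      using eventually_gt_at_top[of 0]
      by eventually_elim (simp only: sigma[OF prob_space_empirical_measure sets_empirical_measure int])
    ultimately show ?case by (rule Lim_transform_eventually)
  qed
qed

theorem corollary8:
  fixes M :: "'w measure"
    and P :: "(real ^ 'm) measure"
    and X :: "nat \<Rightarrow> 'w \<Rightarrow> real ^ 'm"
    and \<alpha> :: real
  assumes "prob_space M"
    and "prob_space.indep_vars M (\<lambda>_. borel) X UNIV"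
    and "\<And>i. distr M borel (X i) = P"
    and "\<And>u c. u \<noteq> 0 \<Longrightarrow> measure P {y. u \<bullet> y = c} = 0"
    and "\<alpha> > 1"
    and "integrable P (\<lambda>x. norm x powr \<alpha>)"
  shows "(AE \<omega> in M. (\<lambda>n. sigma_halfspace (empirical_measure (\<lambda>i. X i \<omega>) n))
            \<longlonglongrightarrow> sigma_halfspace P) \<and>
         (AE \<omega> in M. (\<lambda>n. sigma_simplicial (empirical_measure (\<lambda>i. X i \<omega>) n))
            \<longlonglongrightarrow> sigma_simplicial P)"
proof
  interpret prob_space M by fact
  note iid = assms(2,3)
  show "AE \<omega> in M. (\<lambda>n. sigma_halfspace (empirical_measure (\<lambda>i. X i \<omega>) n)) \<longlonglongrightarrow> sigma_halfspace P"
    using iid assms(4) by (rule sigma_halfspace_empirical_measure_tendsto)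
  have X: "X 0 \<in> M \<rightarrow>\<^sub>M borel"
    using iid(1) by (auto simp: indep_vars_def2)
  have "prob_space P" using prob_space_distr[OF X] iid(2) by simp
  then interpret P: prob_space P .
  have "integrable P norm"
  proof (rule Bochner_Integration.integrable_bound)
    show "integrable P (\<lambda>x. 1 + norm x powr \<alpha>)" using assms(6) by simp
    show "norm \<in> borel_measurable P" using assms(3)[of 0] by auto
    have "norm x \<le> 1 + norm x powr \<alpha>" for x :: "real ^ 'm"
    proof (cases "norm x \<le> 1")
      case False
      then have "norm x powr 1 \<le> norm x powr \<alpha>" using assms(5) by (intro powr_mono) auto
      then show ?thesis by simp
    qed (simp add: add_increasing2)
    then show "AE x in P. norm (norm x) \<le> norm (1 + norm x powr \<alpha>)" by (intro AE_I2) simp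
  qed
  then show "AE \<omega> in M. (\<lambda>n. sigma_simplicial (empirical_measure (\<lambda>i. X i \<omega>) n)) \<longlonglongrightarrow> sigma_simplicial P"
    by (rule sigma_simplicial_empirical_measure_tendsto[OF iid])
qed

end
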